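(* Let $d\in\mathbb{N}^{*}$, let $X$ be a $[0,1]^d$-valued random variable, let $\alpha\in(0,1)$ and let $f:[0,1]^d\to\mathbb{R}$. Assume: (Lipschitz) $L_f\geqslant1$ is such that $|f(x)-f(y)|\leqslant L_f|x-y|$ for all $x,y\in[0,1]^d$ ($|\cdot|$ the Euclidean norm); (Level set) $M>0$ is such that for every $\delta>0$, $\lambda_{\mathrm{Leb}}(\{x\in[0,1]^d : f(x)\in[q_\alpha(f,X)-\delta,\,q_\alpha(f,X)+\delta]\})\leqslant M\delta$, where $\lambda_{\mathrm{Leb}}$ is Lebesgue measure. Let $N\in\mathbb{N}^{*}$ and let $q^{\diamond,N}_\alpha(f,X)$ be defined as in Algorithm B (described in the context, and which does not use $L_f$) with budget $N$. - If $d=1$, then $|q_\alpha(f,X)-q^{\diamond,N}_\alpha(f,X)|\leqslant C\rho^N$ with $$C=18L_f\,3^{\frac{1}{2ML_f}},\qquad \rho=3^{-\frac{1}{\left(\frac{\ln(L_f)}{\ln(3)}+2\right)^2 2\pi^2 M L_f}}.$$ - If $d>1$ and $N>\frac{\pi^2}{3}\left(\frac{\ln(L_f)}{\ln(3)}+2\right)^2$, then $$|q_\alpha(f,X)-q^{\diamond,N}_\alpha(f,X)|\leqslant C\left(N-\frac{\pi^2}{3}\Big(\frac{\ln(L_f)}{\ln(3)}+2\Big)^2\right)^{-\frac{1}{d-1}}$$ with $$C=18L_f d^{\frac12}\left(3^d M L_f d^{\frac12}\,\frac{\pi^2}{2}\Big(\frac{\ln(L_f)}{\ln(3)}+2\B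ig)^2\right)^{\frac{1}{d-1}}.$$
   Context: $\mathbb{N}=\{0,1,2,\dots\}$, $\mathbb{N}^{*}=\{1,2,\dots\}$. The quantile is $q_\alpha(f,X)=\inf\{l\in\mathbb{R} : \mathbb{P}(f(X)\leqslant l)\geqslant\alpha\}$. Subdivision. For $k\in\mathbb{N}$ and $i\in\{0,\dots,3^k-1\}$ let $d_i^k=\frac{2i+1}{2\cdot 3^k}$. For $\beta\in\{0,\dots,3^k-1\}^d$ let $d_\beta^k=(d_{\beta_1}^k,\dots,d_{\beta_d}^k)$ and let $D_\beta^k$ be the set of $x\in[0,1]^d$ such that for each $j$, either $x_j\in[d_{\beta_j}^k-\frac{1}{2\cdot3^k},\,d_{\beta_j}^k+\frac{1}{2\cdot3^k})$, or $\beta_j=3^k-1$ and $x_j=1$. The sets $D_\beta^k$ partition $[0,1]^d$. Let $\delta^k=\sup_{x\in D_\beta^k}|x-d_\beta^k|=\frac{d^{1/2}}{2}3^{-k}$. For $k\geqslant1$ and $\beta\in\{0,\dots,3^k-1\}^d$, the parent index is $\beta^{-[1]}=(\lfloor\beta_1/3\rfloor,\dots,\lfloor\beta_d/3\rfloor)\in\{0,\dots,3^{k-1}-1\}^d$. Candidates and budgets. For $j\in\mathbb{N}$ let $L_f(j)=3^j$ (candidate Lipschitz constants). For a global budget $N$ (introduced with $N\geqslant\frac{\pi^2}{6}$) let $N_{max}(j,N)=\left\lfloor\frac{6N}{\pi^2(j+1)^2}\right\rfloor$ and $j_{max}(N)=\sup\{j\in\mathbb{N} : N_{max}(j,N)\geqslant1\}=\left\lfloor\frac{\sqrt{6N}}{\pi}\right\rfloor-1$.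 Algorithm B (budget $N$). Start with $k=0$, $J=\{1,\dots,j_{max}(N)\}$, $\Pi^{\diamond,0}(j)=\{(0,\dots,0)\}$ for every $j$, and $N_{\mathrm{call}}(j)=1$ for all $j\in J$. While $J\neq\emptyset$, do the following, with $U^k=\bigcup_{j=1}^{j_{max}(N)}\Pi^{\diamond,k}(j)$. 1. Compute $f(d_\beta^k)$ for $\beta\in U^k$ (when $d_\beta^k=d_{\beta^{-[1]}}^{k-1}$, the value is already available). Set $f_\beta^k=f(d_\beta^k)$ for $\beta\in U^k$, and $f_\beta^k=f_{\beta^{-[1]}}^{k-1}$ for $\beta\in\{0,\dots,3^k-1\}^d\setminus U^k$. 2. Set $$q^{\diamond,N}_\alpha(f,X)=\sup\Big\{f(d_\beta^k) : \beta\in U^k,\ \sum_{\gamma\in\{0,\dots,3^k-1\}^d,\ f_\gamma^k\geqslant f(d_\beta^k)}\mathbb{P}(X\in D_\gamma^k)\geqslant1-\alpha\Big\}$$ $$=\inf\Big\{f(d_\beta^k) : \beta\in U^k,\ \sum_{\gamma\in\{0,\dots,3^k-1\}^d,\ f_\gamma^k\leqslant f(d_\beta^k)}\mathbb{P}(X\in D_\gamma^k)\geqslant\alpha\Big\}$$ (the sup expression is the definition; its equality with the inf expression is asserted as part of the algorithm's description). 3. For each $j\in J$: set $\Pi^{\diamond,k+1}(j)=\bigcup\{3\beta+\{0,1,2\}^d : \beta\in\Pi^{\diamond,k}(j),\ f(d_\beta^k)\in[q^{\diamond,N}_\alpha(f,X)-2L_f(j)\delta^k,\ q^{\diamond,N}_\alpha(f,X)+2L_f(j)\delta^k]\}$;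 replace $N_{\mathrm{call}}(j)$ by $N_{\mathrm{call}}(j)+\frac{3^d-1}{3^d}\mathrm{Card}(\Pi^{\diamond,k+1}(j))$; if $N_{\mathrm{call}}(j)>N_{max}(j,N)$, remove $j$ from $J$. 4. For each $j\in\{1,\dots,j_{max}(N)\}\setminus J$, set $\Pi^{\diamond,k+1}(j)=3\Pi^{\diamond,k}(j)+(1,\dots,1)$. 5. Replace $k$ by $k+1$. When the loop ends, return $q^{\diamond,N}_\alpha(f,X)$.
   Formalization: The asserted equality of the sup and inf expressions can fail, and with sup alone the claim is false (f(x)=x, X uniform on {1/10,9/10}, α=1/2). It is proved for sup if both agree at each executed iteration, and for inf always. If N≤6 the loop is not entered: no output. *)

theory Defs
  imports "HOL-Probability.Probability" "HOL-Library.While_Combinator"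
begin

abbreviation unit_cube :: "(real ^ 'n) set"
  where "unit_cube \<equiv> {x. \<forall>i. 0 \<le> x $ i \<and> x $ i \<le> 1}"

definition quantile :: "'a measure \<Rightarrow> ('a \<Rightarrow> real) \<Rightarrow> real \<Rightarrow> real"
  where "quantile P Y \<alpha> = Inf {l. measure P {\<omega> \<in> space P. Y \<omega> \<le> l} \<ge> \<alpha>}"


section \<open>Triadic subdivision of the unit cube\<close>

text \<open>The dimension \<open>d\<close> is \<open>CARD('n)\<close>; multi-indices are vectors \<open>nat ^ 'n\<close>.\<close>

definition grid :: "nat \<Rightarrow> (nat ^ 'n) set"
  where "grid k = {\<beta>. \<forall>i. \<beta> $ i < 3 ^ k}"

definition coord :: "nat \<Rightarrow> nat \<Rightarrow> real"
  where "coord k i = (2 * real i + 1) / (2 * 3 ^ k)"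

definition center :: "nat \<Rightarrow> nat ^ 'n \<Rightarrow> real ^ 'n"
  where "center k \<beta> = (\<chi> i. coord k (\<beta> $ i))"

definition cell :: "nat \<Rightarrow> nat ^ 'n \<Rightarrow> (real ^ 'n) set"
  where "cell k \<beta> = {x \<in> unit_cube. \<forall>i.
    x $ i \<in> {coord k (\<beta> $ i) - 1 / (2 * 3 ^ k) ..< coord k (\<beta> $ i) + 1 / (2 * 3 ^ k)}
    \<or> (\<beta> $ i = 3 ^ k - 1 \<and> x $ i = 1)}"

text \<open>\<open>radius d k\<close> is the supremum of the distances from the points of a level-\<open>k\<close> cell
  to its center, in dimension \<open>d\<close>.\<close>

definition radius :: "nat \<Rightarrow> nat \<Rightarrow> real"
  where "radius d k = sqrt (real d) / 2 / 3 ^ k"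

definition parent :: "nat ^ 'n \<Rightarrow> nat ^ 'n"
  where "parent \<beta> = (\<chi> i. \<beta> $ i div 3)"

definition children :: "nat ^ 'n \<Rightarrow> (nat ^ 'n) set"
  where "children \<beta> = {(\<chi> i. 3 * \<beta> $ i + e $ i) | e. \<forall>i. e $ i \<in> {0, 1, 2}}"

definition central_child :: "nat ^ 'n \<Rightarrow> nat ^ 'n"
  where "central_child \<beta> = (\<chi> i. 3 * \<beta> $ i + 1)"


section \<open>Candidates and budgets\<close>

definition L_cand :: "nat \<Rightarrow> real"
  where "L_cand j = 3 ^ j"

definition N_max :: "nat \<Rightarrow> nat \<Rightarrow> nat"
  where "N_max j N = nat \<lfloor>6 * real N / (pi\<^sup>2 * (real j + 1)\<^sup>2)\<rfloor>"

text \<open>On \<open>nat\<close>, \<open>Sup {} = 0\<close>; this value is used only for \<open>N = 1\<close> and makes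
  \<open>{1..j_max N}\<close> empty, as the value \<open>- 1\<close> of the closed formula does.\<close>

definition j_max :: "nat \<Rightarrow> nat"
  where "j_max N = Sup {j. N_max j N \<ge> 1}"


section \<open>The two expressions for the estimator\<close>

text \<open>\<open>U\<close> is the set \<open>U\<^sup>k\<close> of evaluated indices and \<open>fv \<gamma>\<close> stands for \<open>f\<^sub>\<gamma>\<^sup>k\<close>.\<close>

definition q_sup ::
  "'a measure \<Rightarrow> ('a \<Rightarrow> real ^ 'n) \<Rightarrow> real \<Rightarrow> (real ^ 'n \<Rightarrow> real)
    \<Rightarrow> nat \<Rightarrow> (nat ^ 'n) set \<Rightarrow> (nat ^ 'n \<Rightarrow> real) \<Rightarrow> real"
  where "q_sup P X \<alpha> f k U fv = Sup {f (center k \<beta>) | \<beta>. \<beta> \<in> U \<and>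
    (\<Sum>\<gamma> | \<gamma> \<in> grid k \<and> fv \<gamma> \<ge> f (center k \<beta>).
       measure P {\<omega> \<in> space P. X \<omega> \<in> cell k \<gamma>}) \<ge> 1 - \<alpha>}"

definition q_inf ::
  "'a measure \<Rightarrow> ('a \<Rightarrow> real ^ 'n) \<Rightarrow> real \<Rightarrow> (real ^ 'n \<Rightarrow> real)
    \<Rightarrow> nat \<Rightarrow> (nat ^ 'n) set \<Rightarrow> (nat ^ 'n \<Rightarrow> real) \<Rightarrow> real"
  where "q_inf P X \<alpha> f k U fv = Inf {f (center k \<beta>) | \<beta>. \<beta> \<in> U \<and>
    (\<Sum>\<gamma> | \<gamma> \<in> grid k \<and> fv \<gamma> \<le> f (center k \<beta>).
       measure P {\<omega> \<in> space P. X \<omega> \<in> cell k \<gamma>}) \<ge> \<alpha>}"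


section \<open>Algorithm B\<close>

text \<open>A state is the memory at the beginning of an iteration: the level \<open>k\<close>, the set \<open>J\<close> of
  active candidates, the sets \<open>\<Pi>\<^sup>k(j)\<close>, the call counters, the table \<open>f\<^sup>k\<^sup>-\<^sup>1\<close> of the preceding
  level and the last computed value of the estimator (\<open>None\<close> before the first iteration).\<close>

record 'n alg_state =
  level :: nat
  active :: "nat set"
  selected :: "nat \<Rightarrow> (nat ^ 'n) set"
  calls :: "nat \<Rightarrow> real"
  prev_vals :: "nat ^ 'n \<Rightarrow> real"
  q_val :: "real option"

definition evaluated :: "nat \<Rightarrow> 'n alg_state \<Rightarrow> (nat ^ 'n) set"
  where "evaluated N s = (\<Union>j \<in> {1..j_max N}. selected s j)"

definition cur_vals ::
    "(real ^ 'n \<Rightarrow> real) \<Rightarrow> nat \<Rightarrow> 'n alg_state \<Rightarrow> nat ^ 'n \<Rightarrow> real"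
  where "cur_vals f N s \<beta> =
    (if \<beta> \<in> evaluated N s then f (center (level s) \<beta>) else prev_vals s (parent \<beta>))"

text \<open>The parameter \<open>est\<close> is the expression that computes the estimator from \<open>k\<close>, \<open>U\<^sup>k\<close> and
  \<open>f\<^sup>k\<close>; it is \<open>q_sup P X \<alpha> f\<close> or \<open>q_inf P X \<alpha> f\<close>.\<close>

definition cur_q ::
  "(nat \<Rightarrow> (nat ^ 'n) set \<Rightarrow> (nat ^ 'n \<Rightarrow> real) \<Rightarrow> real)
    \<Rightarrow> (real ^ 'n \<Rightarrow> real) \<Rightarrow> nat \<Rightarrow> 'n alg_state \<Rightarrow> real"
  where "cur_q est f N s = est (level s) (evaluated N s) (cur_vals f N s)"

definition refine ::
  "(real ^ 'n \<Rightarrow> real) \<Rightarrow> real \<Rightarrow> 'n alg_state \<Rightarrow> nat \<Rightarrow> (nat ^ 'n) set"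
  where "refine f q s j = (\<Union>\<beta> \<in> {\<beta> \<in> selected s j. f (center (level s) \<beta>) \<in>
      {q - 2 * L_cand j * radius CARD('n) (level s) ..
       q + 2 * L_cand j * radius CARD('n) (level s)}}. children \<beta>)"

definition body ::
  "(nat \<Rightarrow> (nat ^ 'n) set \<Rightarrow> (nat ^ 'n \<Rightarrow> real) \<Rightarrow> real)
    \<Rightarrow> (real ^ 'n \<Rightarrow> real) \<Rightarrow> nat \<Rightarrow> 'n alg_state \<Rightarrow> 'n alg_state"
  where "body est f N s =
    (let q = cur_q est f N s;
         calls' = (\<lambda>j. if j \<in> active s
            then calls s j + (3 ^ CARD('n) - 1) / 3 ^ CARD('n) * real (card (refine f q s j))
            else calls s j);
         active' = {j \<in> active s. \<not> calls' j > real (N_max j N)}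
     in \<lparr>level = level s + 1,
         active = active',
         selected = (\<lambda>j. if j \<in> active' then refine f q s j
                         else central_child ` selected s j),
         calls = calls',
         prev_vals = cur_vals f N s,
         q_val = Some q\<rparr>)"

text \<open>The initial \<open>prev_vals\<close> is never read, since every index of level \<open>0\<close> is evaluated.\<close>

definition init :: "nat \<Rightarrow> ('n::finite) alg_state"
  where "init N = \<lparr>level = 0, active = {1..j_max N}, selected = (\<lambda>j. {0}),
    calls = (\<lambda>j. 1), prev_vals = (\<lambda>\<beta>. 0), q_val = None\<rparr>"

abbreviation running :: "('n::finite) alg_state \<Rightarrow> bool"
  where "running s \<equiv> active s \<noteq> {}"

definition trace ::
  "(nat \<Rightarrow> (nat ^ 'n) set \<Rightarrow> (nat ^ 'n \<Rightarrow> real) \<Rightarrow> real)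
    \<Rightarrow> (real ^ 'n \<Rightarrow> real) \<Rightarrow> nat \<Rightarrow> nat \<Rightarrow> 'n alg_state"
  where "trace est f N m = ((\<lambda>s. if running s then body est f N s else s) ^^ m) (init N)"

text \<open>The output is the final value of the estimator variable.  If the loop ends, this is the
  returned value (lemma \<open>alg_output_terminating\<close>).  The loop need not end: for a candidate that is
  too small \<open>\<Pi>\<^sup>k(j)\<close> may become empty, after which its counter never exceeds the budget.  Then the
  output is the value at which the estimator stabilises.  There is no output if \<open>j_max N = 0\<close>,
  because the loop is not entered and the estimator is never computed.\<close>

definition alg_output ::
  "(nat \<Rightarrow> (nat ^ 'n) set \<Rightarrow> (nat ^ 'n \<Rightarrow> real) \<Rightarrow> real)
    \<Rightarrow> (real ^ 'n \<Rightarrow> real) \<Rightarrow> nat \<Rightarrow> real \<Rightarrow> bool"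
  where "alg_output est f N q \<longleftrightarrow>
    (\<forall>\<^sub>F m in sequentially. q_val (trace est f N m) = Some q)"

lemma alg_output_terminating:
  assumes "while_option running (body est f N) (init N) = Some s"
  shows "alg_output est f N q \<longleftrightarrow> q_val s = Some q"
proof -
  let ?c = "body est f N" and ?g = "\<lambda>s. if running s then body est f N s else s"
  define k where "k = (LEAST k. \<not> running ((?c ^^ k) (init N)))"
  have ex: "\<exists>k. \<not> running ((?c ^^ k) (init N))" and s: "s = (?c ^^ k) (init N)"
    using assms by (auto simp: while_option_def k_def split: if_splits)
  have stop: "\<not> running s"
    unfolding s k_def by (rule LeastI_ex[OF ex])
  have before: "running ((?c ^^ i) (init N))" if "i < k" for i
    using not_less_Least[of i] that unfolding k_def by blast
  have same: "(?g ^^ i) (init N) = (?c ^^ i) (init N)" if "i \<le> k" for i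
    using that by (induction i) (use before in auto)
  have fin: "trace est f N (i + k) = s" for i
  proof (induction i)
    case 0
    show ?case using same[of k] by (simp add: trace_def s)
  next
    case (Suc i)
    then show ?case using stop by (simp add: trace_def)
  qed
  have "\<forall>\<^sub>F m in sequentially. trace est f N m = s"
    unfolding eventually_sequentially using fin by (metis le_add_diff_inverse2)
  then have "alg_output est f N q \<longleftrightarrow> (\<forall>\<^sub>F m in sequentially. q_val s = Some q)"
    unfolding alg_output_def by (intro eventually_subst) (auto elim: eventually_mono)
  then show ?thesis by simp
qed

text \<open>The equality of the two expressions, asserted at each iteration by the description of the
  algorithm.  It can fail: if the law of \<open>X\<close> is uniform on \<open>{1/10, 9/10}\<close>, \<open>\<alpha> = 1/2\<close> and
  \<open>f x = x\<close>, then at level \<open>1\<close> (executed if \<open>N \<ge> 20\<close>) the supremum is \<open>5/6\<close> and the infimum is \<open>1/6\<close>.\<close>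

definition expressions_agree ::
  "'a measure \<Rightarrow> ('a \<Rightarrow> real ^ 'n) \<Rightarrow> real \<Rightarrow> (real ^ 'n \<Rightarrow> real) \<Rightarrow> nat \<Rightarrow> bool"
  where "expressions_agree P X \<alpha> f N \<longleftrightarrow>
    (\<forall>m. let s = trace (q_sup P X \<alpha> f) f N m in running s \<longrightarrow>
       cur_q (q_sup P X \<alpha> f) f N s = cur_q (q_inf P X \<alpha> f) f N s)"

end

theory Submission
  imports Defs
begin

text \<open>
  The proof follows a single candidate \<open>j\<close> with \<open>L \<le> L_cand j \<le> 3 * L\<close>
  (lemma \<open>exists_good_candidate\<close>) and the level \<open>K\<close> at which its budget is exhausted.

  As long as \<open>j\<close> is active, it rejects a cell only if \<open>f\<close> is strictly on one side of the quantile on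
  the whole cell, and the value stored for a descendant of the cell is on the same side.
  Such cells contribute to the empirical quantile exactly as they should, and on all the other
  cells the stored value is correct up to \<open>L * radius\<close>.  Hence the estimator of level \<open>k\<close> has error at
  most \<open>L * radius d k\<close>, and this in turn justifies the rejections of level \<open>k\<close>
  (lemmas \<open>tracks_error\<close> and \<open>tracks_next_state\<close>).

  After the removal of \<open>j\<close> the other candidates continue to evaluate and to reject cells, possibly
  wrongly.  The error nevertheless never exceeds \<open>2 * L * radius d K\<close>.  Downwards, a stored value below
  \<open>q\<alpha> - L * radius d K\<close> always belongs to a cell on which \<open>f\<close> is bounded away from the quantile
  (lemma \<open>separates_below_next_state\<close>).  Upwards, the sum of the estimator and \<open>L * radius d k\<close> is
  nonincreasing in \<open>k\<close> (lemma \<open>sound_next_state\<close>).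

  It remains to bound \<open>K\<close> from below.  The cells accepted by \<open>j\<close> at level \<open>k \<le> K\<close> lie in the set where \<open>f\<close>
  is within \<open>8 * L * radius d k\<close> of the quantile.  By the level set condition there are at most
  \<open>4 * M * L * sqrt d * 3 ^ (k * (d - 1))\<close> of them (lemma \<open>tracks_calls\<close>).  The calls up to level \<open>K\<close> are
  thus bounded by a geometric sum, linear in \<open>K\<close> for \<open>d = 1\<close> and of order \<open>3 ^ (K * (d - 1))\<close>
  for \<open>d > 1\<close>, and they exceed the budget of \<open>j\<close>, which is of order \<open>N\<close>.  Solving for \<open>3 ^ - K\<close> gives the
  two rates.  If the loop never removes \<open>j\<close>, the limiting value of the estimator is exact; if the budget
  is too small for \<open>j\<close> to exist, which concerns only \<open>d = 1\<close>, the trivial bound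
  \<open>L\<close> by the oscillation of \<open>f\<close> suffices.

  The estimator is analyzed through its infimum expression.  A run with the supremum expression
  is the same run when both expressions agree (lemma \<open>trace_q_sup_eq\<close>).
\<close>

section \<open>Cells, centers and parents\<close>

text \<open>The index of the cell that contains a point.  The minimum with \<open>3 ^ k - 1\<close> puts the
  coordinate value \<open>1\<close>, whose scaled floor is \<open>3 ^ k\<close>, into the last cell.  Events on cells are
  written below as events on \<open>cell_index k (X \<omega>)\<close>, which turns sums of cell probabilities into
  probabilities of single events.\<close>

definition cell_index :: "nat \<Rightarrow> real ^ 'n \<Rightarrow> nat ^ 'n"
  where "cell_index k x = (\<chi> i. min (nat \<lfloor>x $ i * 3 ^ k\<rfloor>) (3 ^ k - 1))"

lemma finite_vec_entries:
  assumes "finite A"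
  shows "finite {\<beta> :: 'b ^ 'n. \<forall>i. \<beta> $ i \<in> A}"
    and "card {\<beta> :: 'b ^ 'n. \<forall>i. \<beta> $ i \<in> A} \<le> card A ^ CARD('n)"
proof -
  let ?F = "PiE (UNIV :: 'n set) (\<lambda>_. A)"
  have fin: "finite ?F"
    using assms by (intro finite_PiE) auto
  have sub: "{\<beta> :: 'b ^ 'n. \<forall>i. \<beta> $ i \<in> A} \<subseteq> vec_lambda ` ?F"
  proof
    fix \<beta> :: "'b ^ 'n" assume "\<beta> \<in> {\<beta>. \<forall>i. \<beta> $ i \<in> A}"
    then have "vec_nth \<beta> \<in> ?F" by auto
    then show "\<beta> \<in> vec_lambda ` ?F" by (metis image_eqI vec_nth_inverse)
  qed
  show "finite {\<beta> :: 'b ^ 'n. \<forall>i. \<beta> $ i \<in> A}"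
    using sub fin finite_surj by blast
  have "card {\<beta> :: 'b ^ 'n. \<forall>i. \<beta> $ i \<in> A} \<le> card ?F"
    using sub fin by (rule surj_card_le[rotated])
  then show "card {\<beta> :: 'b ^ 'n. \<forall>i. \<beta> $ i \<in> A} \<le> card A ^ CARD('n)"
    by (simp add: card_PiE)
qed

lemma finite_grid: "finite (grid k :: (nat ^ 'n) set)"
  using finite_vec_entries(1)[of "{..<3 ^ k :: nat}", where 'n = 'n] by (simp add: grid_def)

lemma children_eq: "children \<beta> = {\<gamma>. parent \<gamma> = \<beta>}"
proof (intro set_eqI iffI)
  fix \<gamma> assume "\<gamma> \<in> children \<beta>"
  then obtain e where \<gamma>: "\<gamma> = (\<chi> i. 3 * \<beta> $ i + e $ i)" and e: "\<And>i. e $ i \<in> {0, 1, 2}"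
    unfolding children_def by blast
  have "(3 * \<beta> $ i + e $ i) div 3 = \<beta> $ i" for i
    using e[of i] by auto
  then show "\<gamma> \<in> {\<gamma>. parent \<gamma> = \<beta>}"
    by (simp add: \<gamma> parent_def vec_eq_iff)
next
  fix \<gamma> assume "\<gamma> \<in> {\<gamma>. parent \<gamma> = \<beta>}"
  then have \<beta>: "\<beta> = parent \<gamma>" by simp
  have "\<gamma> = (\<chi> i. 3 * \<beta> $ i + (\<chi> i. \<gamma> $ i mod 3) $ i)"
    by (simp add: \<beta> parent_def vec_eq_iff)
  moreover have "(\<chi> i. \<gamma> $ i mod 3) $ i \<in> {0, 1, 2}" for i
    using mod_less_divisor[of 3 "\<gamma> $ i"] by auto
  ultimately show "\<gamma> \<in> children \<beta>"
    unfolding children_def by blast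
qed

lemma card_children_le: "card (children (\<beta> :: nat ^ 'n)) \<le> 3 ^ CARD('n)"
proof -
  let ?E = "{e :: nat ^ 'n. \<forall>i. e $ i \<in> {0, 1, 2}}"
  have fin: "finite ?E" by (rule finite_vec_entries(1)) simp
  have "children \<beta> = (\<lambda>e. \<chi> i. 3 * \<beta> $ i + e $ i) ` ?E"
    by (auto simp: children_def)
  then have "card (children \<beta>) \<le> card ?E"
    by (simp only: card_image_le[OF fin])
  also have "\<dots> \<le> 3 ^ CARD('n)"
  proof -
    have "card {0, 1, 2 :: nat} = 3" by simp
    then show ?thesis
      using finite_vec_entries(2)[of "{0, 1, 2 :: nat}", where 'n = 'n] by (simp only: finite.intros simp_thms)
  qed
  finally show ?thesis .
qed

lemma parent_central_child: "parent (central_child \<beta>) = \<beta>"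
proof -
  have "(3 * m + 1) div 3 = m" for m :: nat by arith
  then show ?thesis by (simp only: parent_def central_child_def vec_eq_iff vec_lambda_beta) simp
qed

lemma center_central_child: "center (Suc k) (central_child \<beta>) = center k \<beta>"
  by (simp add: center_def central_child_def coord_def vec_eq_iff field_simps)

lemma parent_in_grid_iff: "parent \<gamma> \<in> grid k \<longleftrightarrow> \<gamma> \<in> grid (Suc k)"
  by (simp add: parent_def grid_def div_less_iff_less_mult mult.commute)

lemma real_index_Suc_le:
  assumes "\<gamma> \<in> grid k"
  shows "real (\<gamma> $ i) + 1 \<le> 3 ^ k"
proof -
  have "\<gamma> $ i + 1 \<le> 3 ^ k" using assms by (auto simp: grid_def Suc_le_eq)
  then have "real (\<gamma> $ i + 1) \<le> real (3 ^ k)" by (rule of_nat_mono)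
  then show ?thesis by simp
qed

lemma cell_index_in_grid: "cell_index k x \<in> grid k"
proof -
  have "min a (3 ^ k - 1) < (3 :: nat) ^ k" for a
    by (metis diff_less less_numeral_extra(1) min.strict_coboundedI2 zero_less_numeral zero_less_power)
  then show ?thesis by (simp add: cell_index_def grid_def)
qed

text \<open>Dividing by three with remainder commutes with the scaled floor and with the truncation at
  the last index, so the cells of two consecutive levels around a point are nested.\<close>

lemma parent_cell_index:
  assumes "x \<in> unit_cube"
  shows "parent (cell_index (Suc k) x) = cell_index k x"
proof -
  have "min (nat \<lfloor>x $ i * 3 ^ Suc k\<rfloor>) (3 ^ Suc k - 1) div 3 = min (nat \<lfloor>x $ i * 3 ^ k\<rfloor>) (3 ^ k - 1)" for i
  proof -
    have "\<lfloor>x $ i * 3 ^ k\<rfloor> = \<lfloor>(x $ i * 3 ^ Suc k) / real_of_int 3\<rfloor>" by simp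
    also have "\<dots> = \<lfloor>x $ i * 3 ^ Suc k\<rfloor> div 3"
      using floor_divide_real_eq_div[of 3 "x $ i * 3 ^ Suc k"] by linarith
    finally have "nat \<lfloor>x $ i * 3 ^ k\<rfloor> = nat \<lfloor>x $ i * 3 ^ Suc k\<rfloor> div 3"
      by (simp add: nat_div_distrib')
    moreover have "(3 ^ Suc k - 1) div 3 = (3 :: nat) ^ k - 1"
    proof -
      have "(3 :: nat) ^ Suc k - 1 = 3 * (3 ^ k - 1) + 2"
        unfolding power_Suc using one_le_power[of "3 :: nat" k] by linarith
      then show ?thesis by simp
    qed
    moreover have "min a b div 3 = min (a div 3) (b div 3)" for a b :: nat
      using div_le_mono[of a b 3] div_le_mono[of b a 3] by (auto simp: min_def)
    ultimately show ?thesis by metis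
  qed
  then show ?thesis by (simp add: parent_def cell_index_def vec_eq_iff)
qed

lemma coord_bounds:
  "coord k i - 1 / (2 * 3 ^ k) = real i / 3 ^ k" "coord k i + 1 / (2 * 3 ^ k) = (real i + 1) / 3 ^ k"
  by (simp_all add: coord_def field_simps)

lemma mem_cell_iff:
  assumes x: "x \<in> unit_cube" and \<gamma>: "\<gamma> \<in> grid k"
  shows "x \<in> cell k \<gamma> \<longleftrightarrow> cell_index k x = \<gamma>"
proof -
  have "(real (\<gamma> $ i) / 3 ^ k \<le> x $ i \<and> x $ i < (real (\<gamma> $ i) + 1) / 3 ^ k \<or> \<gamma> $ i = 3 ^ k - 1 \<and> x $ i = 1)
      \<longleftrightarrow> min (nat \<lfloor>x $ i * 3 ^ k\<rfloor>) (3 ^ k - 1) = \<gamma> $ i" (is "?l \<longleftrightarrow> ?r") for i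
  proof -
    let ?y = "x $ i * 3 ^ k"
    have y: "0 \<le> ?y" "?y \<le> 3 ^ k" and g: "\<gamma> $ i < 3 ^ k"
      using x \<gamma> by (auto simp: grid_def)
    have one: "x $ i = 1 \<longleftrightarrow> ?y = 3 ^ k" by auto
    have l: "?l \<longleftrightarrow> real (\<gamma> $ i) \<le> ?y \<and> ?y < real (\<gamma> $ i) + 1 \<or> \<gamma> $ i = 3 ^ k - 1 \<and> ?y = 3 ^ k"
      unfolding one by (simp add: pos_divide_le_eq pos_less_divide_eq)
    have fl: "real (\<gamma> $ i) \<le> ?y \<and> ?y < real (\<gamma> $ i) + 1 \<longleftrightarrow> nat \<lfloor>?y\<rfloor> = \<gamma> $ i"
      using y(1) by (auto simp: nat_eq_iff floor_eq_iff)
    show ?thesis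
    proof (cases "?y = 3 ^ k")
      case True
      have "real ((3 :: nat) ^ k) = 3 ^ k" by simp
      then have "nat \<lfloor>?y\<rfloor> = 3 ^ k" using True
        by (metis floor_of_nat nat_int)
      then have "min (nat \<lfloor>?y\<rfloor>) (3 ^ k - 1) = 3 ^ k - 1" by (metis diff_le_self min_absorb2)
      then show ?thesis using g \<open>nat \<lfloor>?y\<rfloor> = 3 ^ k\<close> unfolding l fl by (metis True less_irrefl)
    next
      case False
      then have "?y < real (3 ^ k)" using y by simp
      then have "nat \<lfloor>?y\<rfloor> < 3 ^ k" using y(1)
        by (metis floor_less_iff nat_less_iff of_int_of_nat_eq zero_le_floor)
      then have "min (nat \<lfloor>?y\<rfloor>) (3 ^ k - 1) = nat \<lfloor>?y\<rfloor>" by linarith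
      then show ?thesis using False unfolding l fl by simp
    qed
  qed
  then show ?thesis using x
    by (simp add: cell_def coord_bounds cell_index_def vec_eq_iff)
qed

lemma mem_cell_index: "x \<in> unit_cube \<Longrightarrow> x \<in> cell k (cell_index k x)"
  by (simp add: mem_cell_iff cell_index_in_grid)

lemma norm_le_sqrt_card:
  fixes v :: "real ^ 'n"
  assumes "\<And>i. \<bar>v $ i\<bar> \<le> c"
  shows "norm v \<le> sqrt (real CARD('n)) * c"
proof -
  have "0 \<le> c" using assms by (meson abs_ge_zero order_trans)
  have "norm v \<le> L2_set (\<lambda>_. c) (UNIV :: 'n set)"
    unfolding norm_vec_def by (rule L2_set_mono) (use assms in auto)
  then show ?thesis using \<open>0 \<le> c\<close> by (simp add: L2_set_constant)
qed

lemma radius_pos: "0 < radius CARD('n::finite) k"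
  by (simp add: radius_def)

lemma radius_mono: "k \<le> l \<Longrightarrow> radius d l \<le> radius d k"
  by (simp add: radius_def frac_le power_increasing)

lemma center_in_cube:
  assumes "\<gamma> \<in> grid k"
  shows "center k \<gamma> \<in> unit_cube"
proof -
  have "coord k (\<gamma> $ i) \<le> 1" for i
    using real_index_Suc_le[OF assms, of i] by (simp add: coord_def)
  then show ?thesis by (simp add: center_def) (simp add: coord_def)
qed

lemma dist_center_le:
  fixes x :: "real ^ 'n"
  assumes "x \<in> cell k \<gamma>" "\<gamma> \<in> grid k"
  shows "norm (x - center k \<gamma>) \<le> radius CARD('n) k"
proof -
  have "\<bar>(x - center k \<gamma>) $ i\<bar> \<le> 1 / (2 * 3 ^ k)" for i
  proof -
    have "coord k (3 ^ k - 1) + 1 / (2 * 3 ^ k) = 1"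
      using one_le_power[of "3 :: nat" k] by (simp add: coord_bounds(2) of_nat_diff)
    moreover have "x $ i \<in> {coord k (\<gamma> $ i) - 1 / (2 * 3 ^ k) ..< coord k (\<gamma> $ i) + 1 / (2 * 3 ^ k)}
        \<or> \<gamma> $ i = 3 ^ k - 1 \<and> x $ i = 1"
      using assms(1) unfolding cell_def by blast
    moreover have "(x - center k \<gamma>) $ i = x $ i - coord k (\<gamma> $ i)"
      by (simp add: center_def)
    moreover have "0 < 1 / (2 * 3 ^ k :: real)" by simp
    ultimately show ?thesis
      unfolding abs_le_iff atLeastLessThan_iff by (elim disjE conjE) (simp_all only:, linarith+)
  qed
  then have "norm (x - center k \<gamma>) \<le> sqrt (real CARD('n)) * (1 / (2 * 3 ^ k))"
    by (rule norm_le_sqrt_card)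
  then show ?thesis by (simp add: radius_def)
qed

text \<open>A coordinate of the center moves by at most \<open>3 ^ - (k + 1)\<close>, which is the difference of the
  half edge lengths at the two levels.  This bound is exactly \<open>radius k - radius (k + 1)\<close>, so for
  an \<open>L\<close>-Lipschitz \<open>f\<close> the quantity \<open>f (center) + L * radius\<close> never increases along a chain of
  descendants, and \<open>f (center) - L * radius\<close> never decreases.\<close>

lemma dist_center_parent_le:
  fixes \<gamma> :: "nat ^ 'n"
  shows "norm (center (Suc k) \<gamma> - center k (parent \<gamma>)) \<le> radius CARD('n) k - radius CARD('n) (Suc k)"
proof -
  have "\<bar>(center (Suc k) \<gamma> - center k (parent \<gamma>)) $ i\<bar> \<le> 1 / 3 ^ Suc k" for i
  proof -
    define a b where "a = \<gamma> $ i div 3" and "b = \<gamma> $ i mod 3"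
    have g: "\<gamma> $ i = 3 * a + b" and b: "b < 3" by (simp_all add: a_def b_def)
    have "coord (Suc k) (\<gamma> $ i) - coord k a = (real b - 1) / 3 ^ Suc k"
      by (simp add: coord_def g field_simps)
    moreover have "\<bar>real b - 1\<bar> \<le> 1" using b by linarith
    ultimately show ?thesis
      by (simp add: center_def parent_def a_def[symmetric] divide_right_mono)
  qed
  then have "norm (center (Suc k) \<gamma> - center k (parent \<gamma>)) \<le> sqrt (real CARD('n)) * (1 / 3 ^ Suc k)"
    by (rule norm_le_sqrt_card)
  then show ?thesis by (simp add: radius_def)
qed

lemma cell_subset_parent:
  assumes "\<gamma> \<in> grid (Suc k)" "x \<in> cell (Suc k) \<gamma>"
  shows "x \<in> cell k (parent \<gamma>)"
proof -
  have x: "x \<in> unit_cube" using assms(2) by (simp add: cell_def)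
  then have "cell_index (Suc k) x = \<gamma>" using assms mem_cell_iff by blast
  then show ?thesis using parent_cell_index[OF x] mem_cell_index[OF x] by metis
qed

lemma cell_measurable: "cell k (\<gamma> :: nat ^ 'n) \<in> sets borel"
proof -
  define S where "S i = {0..1 :: real} \<inter>
    ({coord k (\<gamma> $ i) - 1 / (2 * 3 ^ k) ..< coord k (\<gamma> $ i) + 1 / (2 * 3 ^ k)}
      \<union> (if \<gamma> $ i = 3 ^ k - 1 then {1} else {}))" for i
  have "S i \<in> sets borel" for i by (simp add: S_def)
  then have "(\<lambda>x. x $ i) -` S i \<in> sets borel" for i
    using measurable_sets_borel[of "\<lambda>x :: real ^ 'n. x $ i" borel "S i"]
    by (simp add: borel_measurable_continuous_onI continuous_on_component)
  then have "(\<Inter>i\<in>(UNIV :: 'n set). (\<lambda>x. x $ i) -` S i) \<in> sets borel" by (intro sets.finite_INT) auto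
  moreover have "cell k \<gamma> = (\<Inter>i\<in>(UNIV :: 'n set). (\<lambda>x. x $ i) -` S i)"
  proof (rule set_eqI)
    fix x :: "real ^ 'n"
    have "x $ i \<in> S i \<longleftrightarrow> (0 \<le> x $ i \<and> x $ i \<le> 1) \<and>
      (x $ i \<in> {coord k (\<gamma> $ i) - 1 / (2 * 3 ^ k) ..< coord k (\<gamma> $ i) + 1 / (2 * 3 ^ k)}
        \<or> (\<gamma> $ i = 3 ^ k - 1 \<and> x $ i = 1))" for i
      unfolding S_def by simp
    then show "x \<in> cell k \<gamma> \<longleftrightarrow> x \<in> (\<Inter>i\<in>(UNIV :: 'n set). (\<lambda>x. x $ i) -` S i)"
      unfolding cell_def INT_iff vimage_eq mem_Collect_eq by blast
  qed
  ultimately show ?thesis by simp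
qed

text \<open>The interiors of the cells are disjoint open cubes of volume \<open>3 ^ - (k * d)\<close> inside \<open>S\<close>.\<close>

lemma card_cells_le_measure:
  fixes A :: "(nat ^ 'n) set"
  assumes A: "A \<subseteq> grid k" and S: "S \<in> lmeasurable" and sub: "\<And>\<gamma>. \<gamma> \<in> A \<Longrightarrow> cell k \<gamma> \<subseteq> S"
  shows "real (card A) \<le> measure lebesgue S * 3 ^ (k * CARD('n))"
proof -
  define B :: "nat ^ 'n \<Rightarrow> (real ^ 'n) set" where
    "B \<gamma> = box (\<chi> i. real (\<gamma> $ i) / 3 ^ k) (\<chi> i. (real (\<gamma> $ i) + 1) / 3 ^ k)" for \<gamma>
  have fin: "finite A" using A finite_grid finite_subset by blast
  have B_cell: "B \<gamma> \<subseteq> cell k \<gamma>" if "\<gamma> \<in> grid k" for \<gamma>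
  proof
    fix x assume "x \<in> B \<gamma>"
    then have x: "real (\<gamma> $ i) / 3 ^ k < x $ i" "x $ i < (real (\<gamma> $ i) + 1) / 3 ^ k" for i
      by (simp_all add: B_def mem_box_cart)
    have "0 \<le> x $ i \<and> x $ i \<le> 1" for i
    proof -
      have "(real (\<gamma> $ i) + 1) / 3 ^ k \<le> 1" using real_index_Suc_le[OF that] by simp
      moreover have "0 \<le> real (\<gamma> $ i) / 3 ^ k" by simp
      ultimately show ?thesis using x[of i] by linarith
    qed
    then show "x \<in> cell k \<gamma>"
      using x by (auto simp: cell_def coord_bounds less_imp_le)
  qed
  have disj: "disjoint_family_on B A"
    unfolding disjoint_family_on_def
  proof (intro ballI impI)
    fix \<gamma> \<gamma>' assume *: "\<gamma> \<in> A" "\<gamma>' \<in> A" "\<gamma> \<noteq> \<gamma>'"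
    show "B \<gamma> \<inter> B \<gamma>' = {}"
    proof (rule ccontr)
      assume "B \<gamma> \<inter> B \<gamma>' \<noteq> {}"
      then obtain x where "x \<in> cell k \<gamma>" "x \<in> cell k \<gamma>'" using B_cell A * by blast
      moreover then have "x \<in> unit_cube" by (simp add: cell_def)
      ultimately show False using mem_cell_iff A * by blast
    qed
  qed
  have meas: "measure lebesgue (B \<gamma>) = 1 / 3 ^ (k * CARD('n))" for \<gamma>
  proof -
    have "measure lebesgue (B \<gamma>) = measure lborel (cbox (\<chi> i. real (\<gamma> $ i) / 3 ^ k) (\<chi> i. (real (\<gamma> $ i) + 1) / 3 ^ k) :: (real^'n) set)"
      unfolding B_def by (simp add: measure_completion measure_lborel_box_eq measure_lborel_cbox_eq)
    also have "\<dots> = (\<Prod>i\<in>(UNIV::'n set). 1 / 3 ^ k)"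
      by (subst content_cbox_cart) (auto simp: interval_ne_empty_cart divide_right_mono add_divide_distrib)
    also have "\<dots> = 1 / 3 ^ (k * CARD('n))"
      by (simp add: power_mult power_one_over)
    finally show ?thesis .
  qed
  have lm: "B \<gamma> \<in> lmeasurable" for \<gamma>
    by (simp add: B_def)
  have ems: "B \<gamma> \<in> sets lebesgue" "emeasure lebesgue (B \<gamma>) \<noteq> \<infinity>" for \<gamma>
    using lm[of \<gamma>] fmeasurableD2[OF lm[of \<gamma>]] by (auto dest: fmeasurableD)
  have "real (card A) / 3 ^ (k * CARD('n)) = (\<Sum>\<gamma>\<in>A. measure lebesgue (B \<gamma>))"
    by (simp add: meas)
  also have "\<dots> = measure lebesgue (\<Union>\<gamma>\<in>A. B \<gamma>)"
    by (rule measure_finite_Union[symmetric]) (use fin disj ems in \<open>simp_all add: image_subset_iff\<close>)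
  also have "\<dots> \<le> measure lebesgue S"
  proof (rule measure_mono_fmeasurable[OF _ _ S])
    show "(\<Union>\<gamma>\<in>A. B \<gamma>) \<subseteq> S" using B_cell A sub by fast
    show "(\<Union>\<gamma>\<in>A. B \<gamma>) \<in> sets lebesgue" using fin ems(1) by (rule sets.finite_UN)
  qed
  finally show ?thesis by (simp add: field_simps)
qed

section \<open>The quantile of a Lipschitz function of a random vector\<close>

locale lipschitz_quantile = prob_space P
  for P :: "'a measure" +
  fixes X :: "'a \<Rightarrow> real ^ 'n" and f :: "real ^ 'n \<Rightarrow> real" and \<alpha> L q\<alpha> :: real
  assumes X_measurable: "X \<in> borel_measurable P"
    and X_cube: "\<And>\<omega>. \<omega> \<in> space P \<Longrightarrow> X \<omega> \<in> unit_cube"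
    and \<alpha>_pos: "0 < \<alpha>" and \<alpha>_less_1: "\<alpha> < 1"
    and q\<alpha>_eq: "q\<alpha> = quantile P (\<lambda>\<omega>. f (X \<omega>)) \<alpha>"
    and L_ge_1: "1 \<le> L"
    and lipschitz: "\<And>x y. x \<in> unit_cube \<Longrightarrow> y \<in> unit_cube \<Longrightarrow> \<bar>f x - f y\<bar> \<le> L * norm (x - y)"
begin

lemma cube_eq_cbox: "unit_cube = (cbox 0 1 :: (real ^ 'n) set)"
  by (auto simp: mem_box_cart)

lemma f_continuous: "continuous_on unit_cube f"
proof -
  have "L-lipschitz_on unit_cube f"
    using lipschitz L_ge_1 by (intro lipschitz_onI) (auto simp: dist_norm)
  then show ?thesis by (rule lipschitz_on_continuous_on)
qed

lemma fX_measurable: "(\<lambda>\<omega>. f (X \<omega>)) \<in> borel_measurable P"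
proof -
  have "X \<in> measurable P (restrict_space borel unit_cube)"
    using _ X_measurable by (rule measurable_restrict_space2) (use X_cube in blast)
  moreover have "f \<in> borel_measurable (restrict_space borel unit_cube)"
    using f_continuous by (rule borel_measurable_continuous_on_restrict)
  ultimately show ?thesis by (rule measurable_compose)
qed

lemma fX_event: "{\<omega> \<in> space P. f (X \<omega>) \<le> l} \<in> events"
  using fX_measurable by measurable

lemma f_image: "connected (f ` unit_cube)" "compact (f ` unit_cube)"
proof -
  have "connected (unit_cube :: (real ^ 'n) set)" "compact (unit_cube :: (real ^ 'n) set)"
    unfolding cube_eq_cbox by (simp_all add: convex_connected)
  then show "connected (f ` unit_cube)" "compact (f ` unit_cube)"
    using f_continuous by (simp_all add: connected_continuous_image compact_continuous_image)
qed

lemma f_bounds: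
  assumes "x \<in> unit_cube"
  shows "Inf (f ` unit_cube) \<le> f x" "f x \<le> Sup (f ` unit_cube)"
  using assms compact_imp_bounded[OF f_image(2)]
  by (simp_all only: cInf_lower cSup_upper imageI bounded_imp_bdd_below bounded_imp_bdd_above)

lemma quantile_set_bdd_below: "bdd_below {l. \<alpha> \<le> prob {\<omega> \<in> space P. f (X \<omega>) \<le> l}}"
proof -
  show ?thesis
  proof (rule bdd_belowI)
    fix l assume "l \<in> {l. \<alpha> \<le> prob {\<omega> \<in> space P. f (X \<omega>) \<le> l}}"
    then have "prob {\<omega> \<in> space P. f (X \<omega>) \<le> l} \<noteq> 0" using \<alpha>_pos by auto
    then have "{\<omega> \<in> space P. f (X \<omega>) \<le> l} \<noteq> {}" by (metis measure_empty)
    then obtain \<omega> where "\<omega> \<in> space P" "f (X \<omega>) \<le> l" by blast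
    then show "Inf (f ` unit_cube) \<le> l" using f_bounds(1)[OF X_cube] by force
  qed
qed

lemma quantile_le:
  assumes "\<alpha> \<le> prob {\<omega> \<in> space P. f (X \<omega>) \<le> l}"
  shows "q\<alpha> \<le> l"
  unfolding q\<alpha>_eq quantile_def by (rule cInf_lower) (use assms quantile_set_bdd_below in auto)

text \<open>The distribution function is right continuous, so the level \<open>\<alpha>\<close>, which it reaches at every
  point above the quantile, is also reached at the quantile.\<close>

lemma prob_le_quantile: "\<alpha> \<le> prob {\<omega> \<in> space P. f (X \<omega>) \<le> q\<alpha>}"
proof -
  let ?S = "{l. \<alpha> \<le> prob {\<omega> \<in> space P. f (X \<omega>) \<le> l}}"
  define D where "D = distr P borel (\<lambda>\<omega>. f (X \<omega>))"
  interpret D: real_distribution D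
    unfolding D_def using fX_measurable by (rule real_distribution_distr)
  have cdf: "cdf D l = prob {\<omega> \<in> space P. f (X \<omega>) \<le> l}" for l
    unfolding cdf_def D_def by (subst measure_distr) (auto simp: fX_measurable intro!: arg_cong[where f = prob])
  have top: "{\<omega> \<in> space P. f (X \<omega>) \<le> Sup (f ` unit_cube)} = space P"
    using f_bounds(2)[OF X_cube] by blast
  have "Sup (f ` unit_cube) \<in> ?S" unfolding mem_Collect_eq top using \<alpha>_less_1 by (simp add: prob_space)
  have "\<alpha> \<le> cdf D l" if "q\<alpha> < l" for l
  proof -
    have "Inf ?S < l" using that by (simp add: q\<alpha>_eq quantile_def)
    then obtain l' where "l' \<in> ?S" "l' < l"
      using cInf_less_iff[of ?S l] \<open>Sup (f ` unit_cube) \<in> ?S\<close> quantile_set_bdd_below by blast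
    then show ?thesis
      using D.cdf_nondecreasing[of l' l] by (simp add: cdf)
  qed
  then have "eventually (\<lambda>l. \<alpha> \<le> cdf D l) (at_right q\<alpha>)"
    by (simp add: eventually_at_filter)
  moreover have "(cdf D \<longlongrightarrow> cdf D q\<alpha>) (at_right q\<alpha>)"
    using D.cdf_is_right_cont by (simp add: continuous_within)
  ultimately have "\<alpha> \<le> cdf D q\<alpha>"
    by (metis tendsto_lowerbound trivial_limit_at_right_real)
  then show ?thesis by (simp add: cdf)
qed

text \<open>The quantile lies between values of \<open>f\<close>, and \<open>f\<close> is continuous on the connected cube.  A point
  where \<open>f\<close> takes the value \<open>q\<alpha>\<close> later guarantees an evaluated center with value close to \<open>q\<alpha>\<close>.\<close>

lemma quantile_attained: "\<exists>x \<in> unit_cube. f x = q\<alpha>"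
proof -
  have "{\<omega> \<in> space P. f (X \<omega>) \<le> q\<alpha>} \<noteq> {}"
    using prob_le_quantile \<alpha>_pos by (metis measure_empty not_le)
  then obtain x where x: "x \<in> unit_cube" "f x \<le> q\<alpha>" using X_cube by blast
  have "f ` unit_cube \<noteq> {}" using x(1) by blast
  from compact_attains_sup[OF f_image(2) this]
  obtain m where "m \<in> f ` unit_cube" and m: "\<forall>z \<in> f ` unit_cube. z \<le> m" by (rule bexE)
  from this(1) obtain y where "m = f y" and y: "y \<in> unit_cube" by (rule imageE)
  have "f (X \<omega>) \<le> f y" if "\<omega> \<in> space P" for \<omega>
    using m imageI[OF X_cube[OF that]] unfolding \<open>m = f y\<close> by (rule bspec)
  then have "{\<omega> \<in> space P. f (X \<omega>) \<le> f y} = space P" by blast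
  then have "q\<alpha> \<le> f y" using \<alpha>_less_1 by (intro quantile_le) (simp add: prob_space)
  then have "q\<alpha> \<in> f ` unit_cube"
    using connectedD_interval[OF f_image(1) imageI[OF x(1)] imageI[OF y]] x(2) by simp
  then obtain z where "q\<alpha> = f z" and "z \<in> unit_cube" by (rule imageE)
  then show ?thesis by (intro bexI[of _ z]) simp_all
qed

lemma level_set_lmeasurable: "{x \<in> unit_cube. f x \<in> {a .. b}} \<in> lmeasurable"
proof -
  have "compact (unit_cube :: (real ^ 'n) set)" unfolding cube_eq_cbox by (rule compact_cbox)
  moreover from this have "closed (unit_cube \<inter> f -` {a .. b})"
    using continuous_closed_preimage[OF f_continuous] by (simp add: compact_imp_closed)
  moreover have "{x \<in> unit_cube. f x \<in> {a .. b}} = unit_cube \<inter> (unit_cube \<inter> f -` {a .. b})"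
    unfolding set_eq_iff mem_Collect_eq Int_iff vimage_eq by simp
  ultimately have "compact {x \<in> unit_cube. f x \<in> {a .. b}}" by (simp only: compact_Int_closed)
  then show ?thesis by (rule lmeasurable_compact)
qed

lemma f_near_center:
  assumes "\<gamma> \<in> grid k" "x \<in> cell k \<gamma>"
  shows "\<bar>f x - f (center k \<gamma>)\<bar> \<le> L * radius CARD('n) k"
proof -
  have "\<bar>f x - f (center k \<gamma>)\<bar> \<le> L * norm (x - center k \<gamma>)"
  proof (rule lipschitz)
    show "x \<in> unit_cube" using assms(2) unfolding cell_def by simp
    show "center k \<gamma> \<in> unit_cube" using assms(1) by (rule center_in_cube)
  qed
  also have "\<dots> \<le> L * radius CARD('n) k"
    using dist_center_le[OF assms(2,1)] L_ge_1 by (intro mult_left_mono) auto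
  finally show ?thesis .
qed

lemma f_center_parent:
  assumes "\<gamma> \<in> grid (Suc k)"
  shows "\<bar>f (center (Suc k) \<gamma>) - f (center k (parent \<gamma>))\<bar> \<le> L * radius CARD('n) k - L * radius CARD('n) (Suc k)"
proof -
  have "\<bar>f (center (Suc k) \<gamma>) - f (center k (parent \<gamma>))\<bar>
      \<le> L * norm (center (Suc k) \<gamma> - center k (parent \<gamma>))"
    by (intro lipschitz center_in_cube assms parent_in_grid_iff[THEN iffD2])
  also have "\<dots> \<le> L * (radius CARD('n) k - radius CARD('n) (Suc k))"
    using dist_center_parent_le[of k \<gamma>] L_ge_1 by (intro mult_left_mono) auto
  finally show ?thesis by (simp add: right_diff_distrib)
qed


section \<open>The empirical quantile of a level\<close>

text \<open>The cells of level \<open>k\<close> are disjoint and cover the cube.\<close>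

lemma cell_index_event: "{\<omega> \<in> space P. Q (cell_index k (X \<omega>))} \<in> events"
  and sum_cell_prob: "(\<Sum>\<gamma> | \<gamma> \<in> grid k \<and> Q \<gamma>. prob {\<omega> \<in> space P. X \<omega> \<in> cell k \<gamma>})
    = prob {\<omega> \<in> space P. Q (cell_index k (X \<omega>))}"
proof -
  let ?A = "{\<gamma>. \<gamma> \<in> grid k \<and> Q \<gamma>}" and ?E = "\<lambda>\<gamma>. {\<omega> \<in> space P. X \<omega> \<in> cell k \<gamma>}"
  have fin: "finite ?A" using finite_grid by (rule finite_subset[rotated]) auto
  have ev: "?E \<gamma> \<in> events" for \<gamma>
    using measurable_sets[OF X_measurable cell_measurable[of k \<gamma>]]
    by (simp add: vimage_def Int_def conj_commute)
  have in_cell: "X \<omega> \<in> cell k \<gamma> \<longleftrightarrow> cell_index k (X \<omega>) = \<gamma>" if "\<omega> \<in> space P" "\<gamma> \<in> grid k" for \<omega> \<gamma>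
    using X_cube[OF that(1)] that(2) by (rule mem_cell_iff)
  have eq: "{\<omega> \<in> space P. Q (cell_index k (X \<omega>))} = (\<Union>\<gamma>\<in>?A. ?E \<gamma>)"
    using cell_index_in_grid by (auto simp: in_cell)
  then show "{\<omega> \<in> space P. Q (cell_index k (X \<omega>))} \<in> events"
    unfolding eq using fin ev by (intro sets.finite_UN)
  have "disjoint_family_on ?E ?A"
    unfolding disjoint_family_on_def by (auto simp: in_cell)
  then show "(\<Sum>\<gamma> | \<gamma> \<in> grid k \<and> Q \<gamma>. prob (?E \<gamma>)) = prob {\<omega> \<in> space P. Q (cell_index k (X \<omega>))}"
    unfolding eq using fin ev by (intro finite_measure_finite_Union[symmetric]) auto
qed

text \<open>The indices over whose values the infimum \<open>q_inf\<close> is taken; the cell sum is rewritten as the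
  probability that the piecewise constant approximation \<open>v\<close> of \<open>f\<close> does not exceed the value.\<close>

definition admissible :: "nat \<Rightarrow> (nat ^ 'n) set \<Rightarrow> (nat ^ 'n \<Rightarrow> real) \<Rightarrow> nat ^ 'n \<Rightarrow> bool"
  where "admissible k U v \<beta> \<longleftrightarrow> \<beta> \<in> U \<and>
    \<alpha> \<le> prob {\<omega> \<in> space P. v (cell_index k (X \<omega>)) \<le> f (center k \<beta>)}"

lemma q_inf_eq: "q_inf P X \<alpha> f k U v = Inf {f (center k \<beta>) | \<beta>. admissible k U v \<beta>}"
  unfolding q_inf_def admissible_def sum_cell_prob by simp

lemma q_inf_le:
  assumes "finite U" "admissible k U v \<beta>"
  shows "q_inf P X \<alpha> f k U v \<le> f (center k \<beta>)"
proof -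
  have "finite {f (center k \<beta>) | \<beta>. admissible k U v \<beta>}"
    using assms(1) by (rule finite_surj[where f = "\<lambda>\<beta>. f (center k \<beta>)"]) (auto simp: admissible_def)
  then show ?thesis unfolding q_inf_eq
    using assms(2) by (intro cInf_lower bdd_below_finite) auto
qed

lemma q_inf_attained:
  assumes "finite U" "admissible k U v \<beta>"
  obtains \<beta>' where "admissible k U v \<beta>'" "q_inf P X \<alpha> f k U v = f (center k \<beta>')"
proof -
  let ?V = "{f (center k \<beta>) | \<beta>. admissible k U v \<beta>}"
  have fin: "finite ?V"
    using assms(1) by (rule finite_surj[where f = "\<lambda>\<beta>. f (center k \<beta>)"]) (auto simp: admissible_def)
  have ne: "?V \<noteq> {}" using assms(2) by auto
  have "Inf ?V \<in> ?V" unfolding cInf_eq_Min[OF fin ne] by (rule Min_in[OF fin ne])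
  then obtain \<beta>' where "Inf ?V = f (center k \<beta>')" "admissible k U v \<beta>'" by blast
  then show ?thesis using that by (simp only: q_inf_eq)
qed

end

section \<open>One iteration of the algorithm\<close>

lemma body_simps:
  "level (body est f N s) = Suc (level s)"
  "prev_vals (body est f N s) = cur_vals f N s"
  "q_val (body est f N s) = Some (cur_q est f N s)"
  by (simp_all add: body_def Let_def)

lemma active_body_subset: "active (body est f N s) \<subseteq> active s"
  by (auto simp: body_def Let_def)

lemma selected_body:
  "selected (body est f N s) j = (if j \<in> active (body est f N s) then refine f (cur_q est f N s) s j
    else central_child ` selected s j)"
  by (simp add: body_def Let_def)

lemma calls_body:
  fixes s :: "'n::finite alg_state"
  assumes "j \<in> active s"
  shows "calls (body est f N s) j = calls s j
    + (3 ^ CARD('n) - 1) / 3 ^ CARD('n) * real (card (refine f (cur_q est f N s) s j))"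
  using assms by (simp add: body_def Let_def)

lemma active_body_iff:
  "j \<in> active (body est f N s) \<longleftrightarrow> j \<in> active s \<and> calls (body est f N s) j \<le> real (N_max j N)"
  by (auto simp: body_def Let_def)

lemma cur_vals_body:
  "cur_vals f N (body est f N s) \<gamma> = (if \<gamma> \<in> evaluated N (body est f N s)
    then f (center (Suc (level s)) \<gamma>) else cur_vals f N s (parent \<gamma>))"
  by (simp add: cur_vals_def body_simps)

lemma mem_refine_iff:
  fixes s :: "'n::finite alg_state"
  shows "\<gamma> \<in> refine f q s j \<longleftrightarrow> parent \<gamma> \<in> selected s j \<and>
    \<bar>f (center (level s) (parent \<gamma>)) - q\<bar> \<le> 2 * L_cand j * radius CARD('n) (level s)"
  unfolding refine_def children_eq by (auto simp: abs_le_iff)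

lemma selected_subset_evaluated: "j \<in> {1..j_max N} \<Longrightarrow> selected s j \<subseteq> evaluated N s"
  unfolding evaluated_def by blast

lemma parent_evaluated:
  assumes "\<gamma> \<in> evaluated N (body est f N s)"
  shows "parent \<gamma> \<in> evaluated N s"
proof -
  obtain j where j: "j \<in> {1..j_max N}" and "\<gamma> \<in> selected (body est f N s) j"
    using assms unfolding evaluated_def by blast
  then have "parent \<gamma> \<in> selected s j"
    by (auto simp: selected_body mem_refine_iff parent_central_child split: if_splits)
  then show ?thesis using selected_subset_evaluated[OF j] by blast
qed

text \<open>A center whose value equals the estimator is accepted by every active candidate that contains
  it, and inactive candidates keep all their centers.\<close>

lemma central_child_evaluated:
  fixes s :: "'n::finite alg_state"
  assumes \<beta>: "\<beta> \<in> evaluated N s" and q: "f (center (level s) \<beta>) = cur_q est f N s"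
  shows "central_child \<beta> \<in> evaluated N (body est f N s)"
proof -
  obtain j where j: "j \<in> {1..j_max N}" "\<beta> \<in> selected s j"
    using \<beta> unfolding evaluated_def by blast
  have "0 \<le> 2 * L_cand j * radius CARD('n) (level s)"
    using radius_pos[where 'n = 'n, of "level s"] by (simp add: L_cand_def)
  then have "central_child \<beta> \<in> refine f (cur_q est f N s) s j"
    using j(2) q by (simp add: mem_refine_iff parent_central_child)
  then have "central_child \<beta> \<in> selected (body est f N s) j"
    using j(2) by (simp add: selected_body)
  then show ?thesis using selected_subset_evaluated[OF j(1)] by blast
qed

lemma card_refine_le:
  fixes s :: "'n::finite alg_state"
  assumes "finite (selected s j)"
  shows "card (refine f q s j) \<le> 3 ^ CARD('n) * card {\<beta> \<in> selected s j.
    \<bar>f (center (level s) \<beta>) - q\<bar> \<le> 2 * L_cand j * radius CARD('n) (level s)}"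
proof -
  let ?A = "{\<beta> \<in> selected s j. \<bar>f (center (level s) \<beta>) - q\<bar> \<le> 2 * L_cand j * radius CARD('n) (level s)}"
  have fin: "finite ?A" using assms by simp
  have "refine f q s j = (\<Union>\<beta>\<in>?A. children \<beta>)"
    by (auto simp: mem_refine_iff children_eq)
  then have "card (refine f q s j) \<le> (\<Sum>\<beta>\<in>?A. card (children \<beta>))"
    using card_UN_le[OF fin] by simp
  also have "\<dots> \<le> (\<Sum>\<beta>\<in>?A. 3 ^ CARD('n))"
    by (rule sum_mono) (rule card_children_le)
  finally show ?thesis by (simp add: mult.commute)
qed


section \<open>Error bounds that hold without any information on the candidates\<close>

context lipschitz_quantile
begin

abbreviation q_at :: "nat \<Rightarrow> 'n alg_state \<Rightarrow> real"
  where "q_at N s \<equiv> cur_q (q_inf P X \<alpha> f) f N s"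

abbreviation next_state :: "nat \<Rightarrow> 'n alg_state \<Rightarrow> 'n alg_state"
  where "next_state N s \<equiv> body (q_inf P X \<alpha> f) f N s"

text \<open>The condition under which the infimum that defines the estimator is a minimum.\<close>

definition sound :: "nat \<Rightarrow> 'n alg_state \<Rightarrow> bool"
  where "sound N s \<longleftrightarrow> evaluated N s \<subseteq> grid (level s) \<and>
    (\<exists>\<beta>. admissible (level s) (evaluated N s) (cur_vals f N s) \<beta>)"

lemma sound_finite: "sound N s \<Longrightarrow> finite (evaluated N s)"
  unfolding sound_def using finite_grid finite_subset by blast

lemma sound_attained:
  assumes "sound N s"
  obtains \<beta> where "\<beta> \<in> evaluated N s" "\<beta> \<in> grid (level s)" "f (center (level s) \<beta>) = q_at N s"
    "\<alpha> \<le> prob {\<omega> \<in> space P. cur_vals f N s (cell_index (level s) (X \<omega>)) \<le> q_at N s}"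
proof -
  obtain \<beta>0 where "admissible (level s) (evaluated N s) (cur_vals f N s) \<beta>0"
    using assms unfolding sound_def by blast
  with sound_finite[OF assms] obtain \<beta> where
    "admissible (level s) (evaluated N s) (cur_vals f N s) \<beta>" "q_at N s = f (center (level s) \<beta>)"
    unfolding cur_q_def by (rule q_inf_attained)
  then show ?thesis using that assms unfolding admissible_def sound_def by auto
qed

lemma q_at_le:
  assumes "sound N s" "admissible (level s) (evaluated N s) (cur_vals f N s) \<beta>"
  shows "q_at N s \<le> f (center (level s) \<beta>)"
  unfolding cur_q_def by (rule q_inf_le[OF sound_finite[OF assms(1)] assms(2)])

text \<open>Between two levels the estimator can rise only by the amount by which evaluated values
  can rise.  The cells with value at most the old estimator have mass at least \<open>\<alpha>\<close>.  Their children
  either inherit this value or are evaluated anew, at a center whose value is larger by at most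
  \<open>L * (radius k - radius (k + 1))\<close>.  The largest evaluated value among the latter
  is admissible at the new level and bounds the new estimator; the central child of the old
  minimizer ensures that it is at least the old estimator, hence at least the inherited values.\<close>

lemma sound_next_state:
  assumes s: "sound N s"
  shows "sound N (next_state N s)"
    and "q_at N (next_state N s) + L * radius CARD('n) (Suc (level s)) \<le> q_at N s + L * radius CARD('n) (level s)"
proof -
  let ?s' = "next_state N s" and ?k = "level s" and ?q = "q_at N s"
  define g where "g \<gamma> = f (center (Suc ?k) \<gamma>)" for \<gamma> :: "nat ^ 'n"
  obtain \<beta> where \<beta>: "\<beta> \<in> evaluated N s" "f (center ?k \<beta>) = ?q"
    and prob: "\<alpha> \<le> prob {\<omega> \<in> space P. cur_vals f N s (cell_index ?k (X \<omega>)) \<le> ?q}"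
    using s by (rule sound_attained)
  have grid: "evaluated N ?s' \<subseteq> grid (Suc ?k)"
    using parent_evaluated s parent_in_grid_iff unfolding sound_def by blast
  define C where "C = {\<gamma> \<in> evaluated N ?s'. f (center ?k (parent \<gamma>)) \<le> ?q}"
  have fin: "finite C" unfolding C_def by (rule finite_subset[OF _ finite_grid[of "Suc ?k"]]) (use grid in blast)
  have cc: "central_child \<beta> \<in> C"
    using central_child_evaluated[of \<beta> N s f, OF \<beta>] \<beta>(2) by (simp add: C_def parent_central_child)
  have "Max (g ` C) \<in> g ` C" using fin cc by (intro Max_in) auto
  then obtain \<gamma>1 where \<gamma>1: "\<gamma>1 \<in> C" "g \<gamma>1 = Max (g ` C)" by auto
  have max: "g \<gamma> \<le> g \<gamma>1" if "\<gamma> \<in> C" for \<gamma>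
    unfolding \<gamma>1(2) using fin that by (intro Max_ge) auto
  \<comment> \<open>A central child has the center of its parent, so the old estimator is among the new values.\<close>
  have q_le: "?q \<le> g \<gamma>1"
    using max[OF cc] \<beta>(2) by (simp add: g_def center_central_child)
  have "cur_vals f N ?s' (cell_index (Suc ?k) (X \<omega>)) \<le> g \<gamma>1"
    if \<omega>: "\<omega> \<in> space P" and le: "cur_vals f N s (cell_index ?k (X \<omega>)) \<le> ?q" for \<omega>
  proof -
    define \<gamma> where "\<gamma> = cell_index (Suc ?k) (X \<omega>)"
    have par: "parent \<gamma> = cell_index ?k (X \<omega>)"
      unfolding \<gamma>_def by (rule parent_cell_index[OF X_cube[OF \<omega>]])
    show ?thesis
    proof (cases "\<gamma> \<in> evaluated N ?s'")
      case True
      then have "f (center ?k (parent \<gamma>)) \<le> ?q"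
        using le parent_evaluated[OF True] unfolding par[symmetric] by (simp add: cur_vals_def)
      then have "\<gamma> \<in> C" using True by (simp add: C_def)
      then show ?thesis using max True unfolding \<gamma>_def[symmetric] by (simp add: cur_vals_body g_def)
    next
      case False
      then show ?thesis using le q_le unfolding \<gamma>_def[symmetric] by (simp add: cur_vals_body par)
    qed
  qed
  then have "{\<omega> \<in> space P. cur_vals f N s (cell_index ?k (X \<omega>)) \<le> ?q}
      \<subseteq> {\<omega> \<in> space P. cur_vals f N ?s' (cell_index (Suc ?k) (X \<omega>)) \<le> g \<gamma>1}" by blast
  then have "\<alpha> \<le> prob {\<omega> \<in> space P. cur_vals f N ?s' (cell_index (Suc ?k) (X \<omega>)) \<le> g \<gamma>1}"
    using prob finite_measure_mono[OF _ cell_index_event] by (meson order_trans)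
  then have adm: "admissible (level ?s') (evaluated N ?s') (cur_vals f N ?s') \<gamma>1"
    using \<gamma>1(1) by (simp add: admissible_def C_def g_def body_simps)
  then show sound': "sound N ?s'"
    using grid unfolding sound_def body_simps by blast
  have "q_at N ?s' \<le> g \<gamma>1"
    using q_at_le[OF sound' adm] by (simp add: g_def body_simps)
  also have "g \<gamma>1 \<le> ?q + (L * radius CARD('n) ?k - L * radius CARD('n) (Suc ?k))"
  proof -
    have "\<gamma>1 \<in> grid (Suc ?k)" and "f (center ?k (parent \<gamma>1)) \<le> ?q" using \<gamma>1(1) grid by (auto simp: C_def)
    then show ?thesis using f_center_parent[of \<gamma>1 ?k] by (simp add: g_def)
  qed
  finally show "q_at N ?s' + L * radius CARD('n) (Suc ?k) \<le> ?q + L * radius CARD('n) ?k" by simp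
qed

lemma L_radius_pos: "0 < L * radius CARD('n) k"
  using radius_pos[where 'n = 'n, of k] L_ge_1 by simp

text \<open>A property of the table of values that excludes underestimation below \<open>b\<close>.  The gap
  between \<open>c\<close> and \<open>q\<alpha>\<close> is essential: \<open>f < q\<alpha>\<close> alone is compatible with
  mass \<open>\<alpha>\<close>, whereas mass \<open>\<alpha>\<close> on a set where \<open>f \<le> c\<close> contradicts the definition of the quantile.\<close>

definition separates_below :: "nat \<Rightarrow> real \<Rightarrow> 'n alg_state \<Rightarrow> bool"
  where "separates_below N b s \<longleftrightarrow> (\<forall>\<gamma> \<in> grid (level s). cur_vals f N s \<gamma> < b \<longrightarrow>
    (\<exists>c < q\<alpha>. \<forall>x \<in> cell (level s) \<gamma>. f x \<le> c))"

text \<open>An inherited value refers to a larger cell, for which the property was known, and a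
  new value controls \<open>f\<close> on its cell up to \<open>L * radius\<close>.  The property therefore survives every
  iteration, whatever the candidates select.\<close>

lemma separates_below_next_state:
  assumes s: "separates_below N b s" and b: "b \<le> q\<alpha> - L * radius CARD('n) (Suc (level s))"
  shows "separates_below N b (next_state N s)"
  unfolding separates_below_def body_simps
proof (intro ballI impI)
  let ?k = "level s"
  fix \<gamma> :: "nat ^ 'n" assume \<gamma>: "\<gamma> \<in> grid (Suc ?k)" and less: "cur_vals f N (next_state N s) \<gamma> < b"
  show "\<exists>c < q\<alpha>. \<forall>x \<in> cell (Suc ?k) \<gamma>. f x \<le> c"
  proof (cases "\<gamma> \<in> evaluated N (next_state N s)")
    case True
    then have "f (center (Suc ?k) \<gamma>) < b" using less by (simp add: cur_vals_body)
    moreover have "f x \<le> f (center (Suc ?k) \<gamma>) + L * radius CARD('n) (Suc ?k)" if "x \<in> cell (Suc ?k) \<gamma>" for x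
      using f_near_center[OF \<gamma> that] by simp
    ultimately show ?thesis
      using b by (intro exI[of _ "f (center (Suc ?k) \<gamma>) + L * radius CARD('n) (Suc ?k)"]) auto
  next
    case False
    then have "cur_vals f N s (parent \<gamma>) < b" using less by (simp add: cur_vals_body)
    moreover have "parent \<gamma> \<in> grid ?k" using \<gamma> by (simp add: parent_in_grid_iff)
    ultimately obtain c where "c < q\<alpha>" "\<forall>x \<in> cell ?k (parent \<gamma>). f x \<le> c"
      using s unfolding separates_below_def by blast
    then show ?thesis using cell_subset_parent[OF \<gamma>] by blast
  qed
qed

text \<open>If the estimator were below \<open>b\<close>, the cells that carry mass \<open>\<alpha>\<close> below it would all have
  \<open>f\<close> bounded away from \<open>q\<alpha>\<close>; being finitely many, they have a common bound \<open>m < q\<alpha>\<close>.\<close>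

lemma separates_below_le:
  assumes s: "sound N s" and sep: "separates_below N b s"
  shows "b \<le> q_at N s"
proof (rule ccontr)
  assume "\<not> b \<le> q_at N s"
  let ?k = "level s" and ?q = "q_at N s"
  define A where "A = {\<gamma> \<in> grid ?k. cur_vals f N s \<gamma> \<le> ?q}"
  have fin: "finite A" unfolding A_def by (rule finite_subset[OF _ finite_grid[of ?k]]) blast
  have "\<exists>c. c < q\<alpha> \<and> (\<forall>x \<in> cell ?k \<gamma>. f x \<le> c)" if "\<gamma> \<in> A" for \<gamma>
    using sep that \<open>\<not> b \<le> ?q\<close> unfolding separates_below_def A_def by auto
  then obtain c where c: "\<And>\<gamma>. \<gamma> \<in> A \<Longrightarrow> c \<gamma> < q\<alpha>"
    "\<And>\<gamma> x. \<gamma> \<in> A \<Longrightarrow> x \<in> cell ?k \<gamma> \<Longrightarrow> f x \<le> c \<gamma>" by metis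
  \<comment> \<open>The element \<open>q\<alpha> - 1\<close> only serves to make the set nonempty.\<close>
  define m where "m = Max (insert (q\<alpha> - 1) (c ` A))"
  have m: "m < q\<alpha>" unfolding m_def using fin c(1) by (subst Max_less_iff) auto
  have "f (X \<omega>) \<le> m" if \<omega>: "\<omega> \<in> space P" and "cur_vals f N s (cell_index ?k (X \<omega>)) \<le> ?q" for \<omega>
  proof -
    have "cell_index ?k (X \<omega>) \<in> A" using that by (simp add: A_def cell_index_in_grid)
    moreover have "X \<omega> \<in> cell ?k (cell_index ?k (X \<omega>))" by (rule mem_cell_index[OF X_cube[OF \<omega>]])
    ultimately have "f (X \<omega>) \<le> c (cell_index ?k (X \<omega>))" by (rule c(2))
    also have "\<dots> \<le> m" unfolding m_def using fin \<open>cell_index ?k (X \<omega>) \<in> A\<close> by (intro Max_ge) auto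
    finally show ?thesis .
  qed
  then have "{\<omega> \<in> space P. cur_vals f N s (cell_index ?k (X \<omega>)) \<le> ?q} \<subseteq> {\<omega> \<in> space P. f (X \<omega>) \<le> m}"
    by blast
  moreover have "\<alpha> \<le> prob {\<omega> \<in> space P. cur_vals f N s (cell_index ?k (X \<omega>)) \<le> ?q}"
    using s by (rule sound_attained)
  ultimately have "\<alpha> \<le> prob {\<omega> \<in> space P. f (X \<omega>) \<le> m}"
    using finite_measure_mono[OF _ fX_event] by (meson order_trans)
  then show False using quantile_le m by fastforce
qed


section \<open>While a candidate above the Lipschitz constant is active\<close>

text \<open>The invariant of a candidate \<open>j\<close> with \<open>L \<le> L_cand j\<close>: on a cell that it has rejected,
  \<open>f\<close> and the stored value lie strictly on the same side of \<open>q\<alpha>\<close>.  The margin \<open>L * radius\<close> in the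
  condition on the center makes it hold on the entire cell, and makes it
  inherited by the descendants, because the margin shrinks with the cells as fast as the centers
  can move.\<close>

definition tracks :: "nat \<Rightarrow> nat \<Rightarrow> 'n alg_state \<Rightarrow> bool"
  where "tracks N j s \<longleftrightarrow> evaluated N s \<subseteq> grid (level s) \<and>
    (\<forall>\<gamma> \<in> grid (level s) - selected s j.
      f (center (level s) \<gamma>) + L * radius CARD('n) (level s) < q\<alpha> \<and>
        cur_vals f N s \<gamma> + L * radius CARD('n) (level s) < q\<alpha> \<or>
      q\<alpha> < f (center (level s) \<gamma>) - L * radius CARD('n) (level s) \<and>
        q\<alpha> < cur_vals f N s \<gamma> - L * radius CARD('n) (level s))"

lemma tracks_separates_below:
  assumes "tracks N j s" and j: "j \<in> {1..j_max N}"
  shows "separates_below N (q\<alpha> - L * radius CARD('n) (level s)) s"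
  unfolding separates_below_def
proof (intro ballI impI)
  let ?k = "level s"
  fix \<gamma> assume \<gamma>: "\<gamma> \<in> grid ?k" and less: "cur_vals f N s \<gamma> < q\<alpha> - L * radius CARD('n) ?k"
  have "f (center ?k \<gamma>) + L * radius CARD('n) ?k < q\<alpha>"
  proof (cases "\<gamma> \<in> selected s j")
    case True
    then have "cur_vals f N s \<gamma> = f (center ?k \<gamma>)"
      using selected_subset_evaluated[OF j] by (auto simp: cur_vals_def)
    then show ?thesis using less by simp
  next
    case False
    then have "\<gamma> \<in> grid ?k - selected s j" using \<gamma> by simp
    then have "f (center ?k \<gamma>) + L * radius CARD('n) ?k < q\<alpha> \<or> q\<alpha> < cur_vals f N s \<gamma> - L * radius CARD('n) ?k"
      using assms(1) unfolding tracks_def by blast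
    then show ?thesis using less L_radius_pos[of ?k] by linarith
  qed
  moreover have "f x \<le> f (center ?k \<gamma>) + L * radius CARD('n) ?k" if "x \<in> cell ?k \<gamma>" for x
    using f_near_center[OF \<gamma> that] by simp
  ultimately show "\<exists>c < q\<alpha>. \<forall>x \<in> cell ?k \<gamma>. f x \<le> c" by blast
qed

text \<open>Take the largest evaluated value not above \<open>q\<alpha> + L * radius\<close>.  It dominates the stored value of
  every cell that meets \<open>{f \<le> q\<alpha>}\<close>, and these cells carry mass at least \<open>\<alpha>\<close>.  For an evaluated
  cell this holds by the choice of the maximum.  The stored value of an unevaluated such cell is less
  than \<open>q\<alpha> - L * radius\<close>, and the maximum is at least this number because the cell that
  contains a point with \<open>f x = q\<alpha>\<close> cannot have been rejected.\<close>

lemma tracks_admissible: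
  assumes t: "tracks N j s" and j: "j \<in> {1..j_max N}"
  obtains \<beta> where "admissible (level s) (evaluated N s) (cur_vals f N s) \<beta>"
    "f (center (level s) \<beta>) \<le> q\<alpha> + L * radius CARD('n) (level s)"
proof -
  let ?k = "level s" and ?r = "L * radius CARD('n) (level s)"
  define g where "g \<gamma> = f (center ?k \<gamma>)" for \<gamma> :: "nat ^ 'n"
  define C where "C = {\<gamma> \<in> evaluated N s. g \<gamma> \<le> q\<alpha> + ?r}"
  have fin: "finite C" unfolding C_def
    by (rule finite_subset[OF _ finite_grid[of ?k]]) (use t in \<open>auto simp: tracks_def\<close>)
  obtain x where x: "x \<in> unit_cube" "f x = q\<alpha>" using quantile_attained by (rule bexE)
  define \<beta>0 where "\<beta>0 = cell_index ?k x"
  have \<beta>0: "\<beta>0 \<in> grid ?k" unfolding \<beta>0_def by (rule cell_index_in_grid)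
  have near: "\<bar>q\<alpha> - g \<beta>0\<bar> \<le> ?r"
    using f_near_center[OF \<beta>0, of x] mem_cell_index[OF x(1)] x(2) by (simp add: \<beta>0_def g_def)
  then have "\<beta>0 \<in> selected s j"
    using t \<beta>0 unfolding tracks_def g_def by (smt (verit, best) DiffI)
  then have \<beta>0_C: "\<beta>0 \<in> C"
    using selected_subset_evaluated[OF j] near by (auto simp: C_def)
  have "Max (g ` C) \<in> g ` C" using fin \<beta>0_C by (intro Max_in) auto
  then obtain \<beta> where \<beta>: "\<beta> \<in> C" "g \<beta> = Max (g ` C)" by auto
  have max: "g \<gamma> \<le> g \<beta>" if "\<gamma> \<in> C" for \<gamma>
    unfolding \<beta>(2) using fin that by (intro Max_ge) auto
  have "cur_vals f N s (cell_index ?k (X \<omega>)) \<le> g \<beta>"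
    if \<omega>: "\<omega> \<in> space P" and le: "f (X \<omega>) \<le> q\<alpha>" for \<omega>
  proof -
    define \<gamma> where "\<gamma> = cell_index ?k (X \<omega>)"
    have \<gamma>: "\<gamma> \<in> grid ?k" unfolding \<gamma>_def by (rule cell_index_in_grid)
    have close: "\<bar>f (X \<omega>) - g \<gamma>\<bar> \<le> ?r"
      unfolding g_def \<gamma>_def by (rule f_near_center[OF cell_index_in_grid mem_cell_index[OF X_cube[OF \<omega>]]])
    have "cur_vals f N s \<gamma> \<le> g \<beta>"
    proof (cases "\<gamma> \<in> evaluated N s")
      case True
      then have "\<gamma> \<in> C" using close le by (simp add: C_def)
      then show ?thesis using max True by (simp add: cur_vals_def g_def)
    next
      case False
      then have "\<gamma> \<in> grid ?k - selected s j" using selected_subset_evaluated[OF j] \<gamma> by blast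
      then have "cur_vals f N s \<gamma> + ?r < q\<alpha> \<or> q\<alpha> < g \<gamma> - ?r"
        using t unfolding tracks_def g_def by blast
      then show ?thesis using close le near max[OF \<beta>0_C] by linarith
    qed
    then show ?thesis by (simp add: \<gamma>_def)
  qed
  then have "{\<omega> \<in> space P. f (X \<omega>) \<le> q\<alpha>}
      \<subseteq> {\<omega> \<in> space P. cur_vals f N s (cell_index ?k (X \<omega>)) \<le> g \<beta>}" by blast
  then have "\<alpha> \<le> prob {\<omega> \<in> space P. cur_vals f N s (cell_index ?k (X \<omega>)) \<le> g \<beta>}"
    using prob_le_quantile finite_measure_mono[OF _ cell_index_event] by (meson order_trans)
  then show ?thesis
    using that[of \<beta>] \<beta>(1) by (simp add: admissible_def C_def g_def)
qed

lemma tracks_sound: "tracks N j s \<Longrightarrow> j \<in> {1..j_max N} \<Longrightarrow> sound N s"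
  using tracks_admissible[of N j s] unfolding sound_def tracks_def by blast

lemma tracks_error:
  assumes t: "tracks N j s" and j: "j \<in> {1..j_max N}"
  shows "\<bar>q_at N s - q\<alpha>\<bar> \<le> L * radius CARD('n) (level s)"
proof -
  obtain \<beta> where \<beta>: "admissible (level s) (evaluated N s) (cur_vals f N s) \<beta>"
    "f (center (level s) \<beta>) \<le> q\<alpha> + L * radius CARD('n) (level s)"
    using t j by (rule tracks_admissible)
  have "q_at N s \<le> f (center (level s) \<beta>)"
    by (rule q_at_le[OF tracks_sound[OF t j] \<beta>(1)])
  moreover have "q\<alpha> - L * radius CARD('n) (level s) \<le> q_at N s"
    by (rule separates_below_le[OF tracks_sound[OF t j] tracks_separates_below[OF t j]])
  ultimately show ?thesis using \<beta>(2) by linarith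
qed

text \<open>A rejected center has a value at distance more than \<open>2 * L * radius\<close> from the estimator, which
  is itself within \<open>L * radius\<close> of \<open>q\<alpha>\<close>.\<close>

lemma tracks_next_state:
  assumes t: "tracks N j s" and j: "j \<in> {1..j_max N}" and L: "L \<le> L_cand j"
    and act: "j \<in> active (next_state N s)"
  shows "tracks N j (next_state N s)"
  unfolding tracks_def body_simps
proof (intro conjI ballI)
  let ?s' = "next_state N s" and ?k = "level s"
  let ?r = "L * radius CARD('n) (level s)" and ?r' = "L * radius CARD('n) (Suc (level s))"
  show "evaluated N ?s' \<subseteq> grid (Suc ?k)"
    using parent_evaluated t parent_in_grid_iff unfolding tracks_def by blast
  fix \<gamma> assume \<gamma>: "\<gamma> \<in> grid (Suc ?k) - selected ?s' j"
  have p: "parent \<gamma> \<in> grid ?k" using \<gamma> by (simp add: parent_in_grid_iff)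
  have dist: "\<bar>f (center (Suc ?k) \<gamma>) - f (center ?k (parent \<gamma>))\<bar> \<le> ?r - ?r'"
    using \<gamma> by (intro f_center_parent) simp
  have "?r' \<le> ?r" using dist by linarith
  have par: "f (center ?k (parent \<gamma>)) + ?r < q\<alpha> \<and> cur_vals f N s (parent \<gamma>) + ?r < q\<alpha> \<or>
    q\<alpha> < f (center ?k (parent \<gamma>)) - ?r \<and> q\<alpha> < cur_vals f N s (parent \<gamma>) - ?r"
  proof (cases "parent \<gamma> \<in> selected s j")
    case True
    then have eq: "cur_vals f N s (parent \<gamma>) = f (center ?k (parent \<gamma>))"
      using selected_subset_evaluated[OF j] by (auto simp: cur_vals_def)
    have "\<gamma> \<notin> refine f (q_at N s) s j" using \<gamma> act by (simp add: selected_body)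
    then have "2 * L_cand j * radius CARD('n) ?k < \<bar>f (center ?k (parent \<gamma>)) - q_at N s\<bar>"
      using True by (simp add: mem_refine_iff)
    moreover have "?r \<le> L_cand j * radius CARD('n) ?k"
      using L radius_pos[where 'n = 'n, of ?k] by (intro mult_right_mono) auto
    ultimately have "2 * ?r < \<bar>f (center ?k (parent \<gamma>)) - q_at N s\<bar>" by simp
    then show ?thesis using tracks_error[OF t j] unfolding eq by linarith
  next
    case False
    then show ?thesis using t p unfolding tracks_def by blast
  qed
  have "cur_vals f N ?s' \<gamma> = f (center (Suc ?k) \<gamma>) \<or> cur_vals f N ?s' \<gamma> = cur_vals f N s (parent \<gamma>)"
    by (simp add: cur_vals_body)
  then show "f (center (Suc ?k) \<gamma>) + ?r' < q\<alpha> \<and> cur_vals f N ?s' \<gamma> + ?r' < q\<alpha> \<or>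
    q\<alpha> < f (center (Suc ?k) \<gamma>) - ?r' \<and> q\<alpha> < cur_vals f N ?s' \<gamma> - ?r'"
    using par dist \<open>?r' \<le> ?r\<close> by linarith
qed

lemma grid_0: "grid 0 = {0 :: nat ^ 'n}"
  by (auto simp: grid_def vec_eq_iff)

lemma tracks_init: "j \<in> {1..j_max N} \<Longrightarrow> tracks N j (init N)"
  unfolding tracks_def by (auto simp: grid_0 evaluated_def init_def)

lemma sound_init:
  assumes "1 \<le> j_max N"
  shows "sound N (init N)"
  using tracks_sound[OF tracks_init, of 1 N] assms by simp

text \<open>Both numbers are values of \<open>f\<close> on the cube, whose diameter is \<open>sqrt d\<close>.  This crude bound serves
  when the budget admits no sufficiently large candidate.\<close>

lemma sound_error:
  assumes "sound N s"
  shows "\<bar>q_at N s - q\<alpha>\<bar> \<le> L * sqrt (real CARD('n))"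
proof -
  obtain \<beta> where \<beta>: "\<beta> \<in> grid (level s)" "f (center (level s) \<beta>) = q_at N s"
    using assms by (rule sound_attained)
  have c: "center (level s) \<beta> \<in> unit_cube" using \<beta>(1) by (rule center_in_cube)
  obtain x where x: "x \<in> unit_cube" "f x = q\<alpha>" using quantile_attained by (rule bexE)
  have "\<bar>(center (level s) \<beta> - x) $ i\<bar> \<le> 1" for i
    using c x(1) by (simp add: abs_le_iff) (smt (verit))
  then have "norm (center (level s) \<beta> - x) \<le> sqrt (real CARD('n)) * 1"
    by (rule norm_le_sqrt_card)
  then have "L * norm (center (level s) \<beta> - x) \<le> L * sqrt (real CARD('n))"
    using L_ge_1 by (intro mult_left_mono) auto
  then show ?thesis using lipschitz[OF c x(1)] \<beta>(2) x(2) by simp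
qed


section \<open>The budget and the size of the error\<close>

text \<open>On an accepted cell \<open>f\<close> differs from \<open>q\<alpha>\<close> by at most \<open>(6 + 1 + 1) * L * radius\<close>: the acceptance
  threshold with \<open>L_cand j \<le> 3 * L\<close>, the error of the estimator, and the oscillation around the
  center.  The level set condition then bounds the total volume of the accepted cells.\<close>

lemma tracks_calls:
  assumes t: "tracks N j s" and j: "j \<in> {1..j_max N}" and act: "j \<in> active s"
    and cand: "L_cand j \<le> 3 * L"
    and level_set: "\<And>\<delta>. \<delta> > 0 \<Longrightarrow>
      measure lebesgue {x \<in> unit_cube. f x \<in> {q\<alpha> - \<delta> .. q\<alpha> + \<delta>}} \<le> M * \<delta>"
  shows "calls (next_state N s) j
    \<le> calls s j + (3 ^ CARD('n) - 1) * (4 * M * L * sqrt (real CARD('n))) * (3 ^ (CARD('n) - 1)) ^ level s"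
proof -
  let ?k = "level s" and ?q = "q_at N s" and ?d = "CARD('n)"
  let ?r = "L * radius CARD('n) (level s)"
  define A where "A = {\<beta> \<in> selected s j. \<bar>f (center ?k \<beta>) - ?q\<bar> \<le> 2 * L_cand j * radius ?d ?k}"
  have grid: "selected s j \<subseteq> grid ?k"
    using t selected_subset_evaluated[OF j] unfolding tracks_def by blast
  have A_grid: "A \<subseteq> grid ?k" using grid unfolding A_def by blast
  have sub: "cell ?k \<beta> \<subseteq> {x \<in> unit_cube. f x \<in> {q\<alpha> - 8 * ?r .. q\<alpha> + 8 * ?r}}" if "\<beta> \<in> A" for \<beta>
  proof
    fix x assume x: "x \<in> cell ?k \<beta>"
    have "\<bar>f x - f (center ?k \<beta>)\<bar> \<le> ?r"
      using A_grid that x by (intro f_near_center) auto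
    moreover have "\<bar>f (center ?k \<beta>) - ?q\<bar> \<le> 2 * (3 * L) * radius ?d ?k"
    proof -
      have "2 * L_cand j * radius ?d ?k \<le> 2 * (3 * L) * radius ?d ?k"
        using cand radius_pos[where 'n = 'n, of ?k] by (intro mult_right_mono) auto
      then show ?thesis using that by (simp add: A_def)
    qed
    ultimately have "f x \<in> {q\<alpha> - 8 * ?r .. q\<alpha> + 8 * ?r}"
      using tracks_error[OF t j] by (simp add: abs_le_iff)
    moreover have "x \<in> unit_cube" using x by (simp add: cell_def)
    ultimately show "x \<in> {x \<in> unit_cube. f x \<in> {q\<alpha> - 8 * ?r .. q\<alpha> + 8 * ?r}}" by simp
  qed
  have d: "?k * ?d = ?k + (?d - 1) * ?k"
    by (cases "CARD('n)") auto
  have "real (card A) \<le> measure lebesgue {x \<in> unit_cube. f x \<in> {q\<alpha> - 8 * ?r .. q\<alpha> + 8 * ?r}} * 3 ^ (?k * ?d)"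
    using A_grid level_set_lmeasurable sub by (rule card_cells_le_measure)
  also have "\<dots> \<le> M * (8 * ?r) * 3 ^ (?k * ?d)"
    by (intro mult_right_mono level_set) (use L_radius_pos[of ?k] in simp_all)
  also have "\<dots> = 4 * M * L * sqrt (real ?d) * (3 ^ (?d - 1)) ^ ?k"
  proof -
    have pow: "(3 :: real) ^ (?k * ?d) = 3 ^ ?k * (3 ^ (?d - 1)) ^ ?k"
      by (simp only: d power_add power_mult)
    have "M * (8 * (L * (w / 2 / t))) * (t * v) = 4 * M * L * w * v" if "t \<noteq> 0" for w t v :: real
      using that by simp
    then show ?thesis unfolding pow radius_def by simp
  qed
  finally have card_A: "real (card A) \<le> 4 * M * L * sqrt (real ?d) * (3 ^ (?d - 1)) ^ ?k" .
  have "real (card (refine f ?q s j)) \<le> 3 ^ ?d * real (card A)"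
  proof -
    have "finite (selected s j)" using grid finite_grid by (rule finite_subset)
    then have "card (refine f ?q s j) \<le> 3 ^ ?d * card A"
      unfolding A_def by (rule card_refine_le)
    then have "real (card (refine f ?q s j)) \<le> real (3 ^ ?d * card A)" by (rule of_nat_mono)
    then show ?thesis by simp
  qed
  then have "(3 ^ ?d - 1) / 3 ^ ?d * real (card (refine f ?q s j)) \<le> (3 ^ ?d - 1) / 3 ^ ?d * (3 ^ ?d * real (card A))"
    by (intro mult_left_mono) auto
  also have "\<dots> = (3 ^ ?d - 1) * real (card A)" by simp
  also have "\<dots> \<le> (3 ^ ?d - 1) * (4 * M * L * sqrt (real ?d) * (3 ^ (?d - 1)) ^ ?k)"
    using card_A by (intro mult_left_mono) auto
  finally show ?thesis unfolding calls_body[OF act] by (simp add: mult.assoc)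
qed

abbreviation run :: "nat \<Rightarrow> nat \<Rightarrow> 'n alg_state"
  where "run N m \<equiv> trace (q_inf P X \<alpha> f) f N m"

lemma run_Suc: "run N (Suc m) = (if running (run N m) then next_state N (run N m) else run N m)"
  by (simp add: trace_def)

lemma run_0: "run N 0 = init N"
  by (simp add: trace_def)

lemma active_run_Suc: "j \<in> active (run N (Suc m)) \<Longrightarrow> j \<in> active (run N m)"
  using active_body_subset by (fastforce simp: run_Suc split: if_splits)

lemma run_tracks:
  assumes j: "j \<in> {1..j_max N}" and L: "L \<le> L_cand j" and "j \<in> active (run N m)"
  shows "level (run N m) = m" "tracks N j (run N m)"
proof -
  have "level (run N m) = m \<and> tracks N j (run N m)"
    using assms(3)
  proof (induction m)
    case 0
    then show ?case using tracks_init[OF j] by (simp add: run_0) (simp add: init_def)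
  next
    case (Suc m)
    have act: "j \<in> active (run N m)" using Suc.prems by (rule active_run_Suc)
    then have step: "run N (Suc m) = next_state N (run N m)" by (auto simp: run_Suc)
    show ?case
      using Suc act tracks_next_state[OF _ j L] unfolding step by (simp add: body_simps)
  qed
  then show "level (run N m) = m" "tracks N j (run N m)" by simp_all
qed

lemma run_calls:
  assumes j: "j \<in> {1..j_max N}" and L: "L \<le> L_cand j" "L_cand j \<le> 3 * L"
    and level_set: "\<And>\<delta>. \<delta> > 0 \<Longrightarrow>
      measure lebesgue {x \<in> unit_cube. f x \<in> {q\<alpha> - \<delta> .. q\<alpha> + \<delta>}} \<le> M * \<delta>"
    and "j \<in> active (run N m)"
  shows "calls (next_state N (run N m)) j \<le> 1 + (3 ^ CARD('n) - 1) *
    (4 * M * L * sqrt (real CARD('n))) * (\<Sum>i<Suc m. (3 ^ (CARD('n) - 1)) ^ i)"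
  using assms(5)
proof (induction m)
  case 0
  then show ?case
    using tracks_calls[OF run_tracks(2)[OF j L(1) 0] j 0 L(2) level_set] run_tracks(1)[OF j L(1) 0]
    by (simp add: run_0) (simp add: init_def)
next
  case (Suc m)
  have act: "j \<in> active (run N m)" using Suc.prems by (rule active_run_Suc)
  then have step: "run N (Suc m) = next_state N (run N m)" by (auto simp: run_Suc)
  have "calls (next_state N (run N (Suc m))) j \<le> calls (run N (Suc m)) j + (3 ^ CARD('n) - 1) *
      (4 * M * L * sqrt (real CARD('n))) * (3 ^ (CARD('n) - 1)) ^ Suc m"
    using tracks_calls[OF run_tracks(2)[OF j L(1) Suc.prems] j Suc.prems L(2) level_set]
    unfolding run_tracks(1)[OF j L(1) Suc.prems] .
  then show ?case
    using Suc.IH[OF act] unfolding sum.lessThan_Suc[of _ "Suc m"] by (simp only: step distrib_left)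
qed

text \<open>After the removal the precision of level \<open>K\<close> is preserved, up to a factor two above.  The lower
  bound persists because \<open>separates_below\<close> does, and the upper bound because
  \<open>estimator + L * radius\<close> is nonincreasing.\<close>

lemma run_after_removal:
  assumes j: "j \<in> {1..j_max N}" and L: "L \<le> L_cand j"
    and act: "j \<in> active (run N K)" and inact: "j \<notin> active (run N (Suc K))"
  shows "\<exists>q. q_val (run N (Suc K + i)) = Some q \<and> \<bar>q - q\<alpha>\<bar> \<le> 2 * L * radius CARD('n) K"
proof -
  note t = run_tracks(2)[OF j L act] and lev = run_tracks(1)[OF j L act]
  let ?r = "\<lambda>k. L * radius CARD('n) k" and ?b = "q\<alpha> - L * radius CARD('n) K"
  have err: "\<bar>q_at N (run N K) - q\<alpha>\<bar> \<le> ?r K" using tracks_error[OF t j] by (simp add: lev)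
  have r_mono: "?r l \<le> ?r k" if "k \<le> l" for k l
    using radius_mono[OF that] L_ge_1 by (intro mult_left_mono) auto
  have "sound N (run N (Suc K + i)) \<and> separates_below N ?b (run N (Suc K + i))
      \<and> K \<le> level (run N (Suc K + i))
      \<and> q_at N (run N (Suc K + i)) + ?r (level (run N (Suc K + i))) \<le> q\<alpha> + 2 * ?r K
      \<and> (\<exists>q. q_val (run N (Suc K + i)) = Some q \<and> \<bar>q - q\<alpha>\<bar> \<le> 2 * ?r K)"
  proof (induction i)
    case 0
    have step: "run N (Suc K) = next_state N (run N K)" using act by (auto simp: run_Suc)
    have "sound N (run N K)" using t j by (rule tracks_sound)
    note next_sound = sound_next_state[OF this, unfolded lev]
    have "separates_below N ?b (run N K)" using tracks_separates_below[OF t j] by (simp add: lev)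
    then have sep: "separates_below N ?b (next_state N (run N K))"
      by (rule separates_below_next_state) (use r_mono[of K "Suc K"] in \<open>simp add: lev\<close>)
    have "q_at N (next_state N (run N K)) + ?r (Suc K) \<le> q\<alpha> + 2 * ?r K"
      using next_sound(2) err by linarith
    then show ?case
      using sep next_sound(1) err L_radius_pos[of K] by (simp add: step lev body_simps)
  next
    case (Suc i)
    let ?s = "run N (Suc K + i)"
    show ?case
    proof (cases "running ?s")
      case False
      then show ?thesis using Suc by (simp add: run_Suc)
    next
      case True
      then have step: "run N (Suc K + Suc i) = next_state N ?s" by (simp add: run_Suc)
      have s: "sound N ?s" "separates_below N ?b ?s" "K \<le> level ?s"
        "q_at N ?s + ?r (level ?s) \<le> q\<alpha> + 2 * ?r K" using Suc by blast+
      have sep: "separates_below N ?b (next_state N ?s)"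
        using s(2) by (rule separates_below_next_state) (use r_mono[of K "Suc (level ?s)"] s(3) in simp)
      have "?b \<le> q_at N ?s" using s(1,2) by (rule separates_below_le)
      then have "\<bar>q_at N ?s - q\<alpha>\<bar> \<le> 2 * ?r K"
        using s(4) L_radius_pos[of K] L_radius_pos[of "level ?s"] by linarith
      then show ?thesis
        using sep sound_next_state[OF s(1)] s(3,4) unfolding step body_simps by auto
    qed
  qed
  then show ?thesis by (simp add: mult.assoc)
qed

text \<open>A candidate that is never removed forces the loop to run through all levels, so the value at
  which the estimator stabilizes has error zero.  Otherwise the candidate is removed at some level
  \<open>K\<close>, and the number of calls that exhausted its budget is bounded in terms of \<open>K\<close>.\<close>

lemma output_error_or_budget_exceeded:
  assumes j: "j \<in> {1..j_max N}" and L: "L \<le> L_cand j" "L_cand j \<le> 3 * L"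
    and level_set: "\<And>\<delta>. \<delta> > 0 \<Longrightarrow>
      measure lebesgue {x \<in> unit_cube. f x \<in> {q\<alpha> - \<delta> .. q\<alpha> + \<delta>}} \<le> M * \<delta>"
    and out: "alg_output (q_inf P X \<alpha> f) f N q"
  obtains "q = q\<alpha>"
  | K where "\<bar>q - q\<alpha>\<bar> \<le> 2 * L * radius CARD('n) K"
    "real (N_max j N) < 1 + (3 ^ CARD('n) - 1) *
      (4 * M * L * sqrt (real CARD('n))) * (\<Sum>i<Suc K. (3 ^ (CARD('n) - 1)) ^ i)"
proof -
  obtain m0 where m0: "\<And>m. m0 \<le> m \<Longrightarrow> q_val (run N m) = Some q"
    using out unfolding alg_output_def eventually_sequentially by blast
  show ?thesis
  proof (cases "\<forall>m. j \<in> active (run N m)")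
    case True
    have bound: "\<bar>q - q\<alpha>\<bar> \<le> L * radius CARD('n) m" if "m0 \<le> m" for m
    proof -
      have act: "j \<in> active (run N m)" using True by blast
      then have "q_val (run N (Suc m)) = Some (q_at N (run N m))"
        by (auto simp: run_Suc body_simps)
      then have "q = q_at N (run N m)" using m0[of "Suc m"] that by simp
      then show ?thesis
        using tracks_error[OF run_tracks(2)[OF j L(1) act] j] by (simp add: run_tracks(1)[OF j L(1) act])
    qed
    have lim: "(\<lambda>m. L * radius CARD('n) m) \<longlonglongrightarrow> 0"
    proof -
      have "(\<lambda>m. (L * (sqrt (real CARD('n)) / 2)) * (1 / 3) ^ m) \<longlonglongrightarrow> (L * (sqrt (real CARD('n)) / 2)) * 0"
        by (intro tendsto_mult_left LIMSEQ_power_zero) auto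
      then show ?thesis by (simp add: radius_def power_one_over)
    qed
    have "\<bar>q - q\<alpha>\<bar> \<le> 0"
      by (rule LIMSEQ_le_const[OF lim]) (use bound in blast)
    then show ?thesis using that(1) by simp
  next
    case False
    have start: "j \<in> active (run N 0)" using j by (simp add: run_0) (simp add: init_def)
    obtain K where act: "j \<in> active (run N K)" and inact: "j \<notin> active (run N (Suc K))"
    proof (rule ccontr)
      assume "\<not> thesis"
      then have "j \<in> active (run N m) \<longrightarrow> j \<in> active (run N (Suc m))" for m using that by blast
      then have "j \<in> active (run N m)" for m by (induction m) (use start in simp_all)
      then show False using False by blast
    qed
    have "real (N_max j N) < calls (next_state N (run N K)) j"
      using act inact by (auto simp: run_Suc active_body_iff split: if_splits)
    also have "\<dots> \<le> 1 + (3 ^ CARD('n) - 1) *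
      (4 * M * L * sqrt (real CARD('n))) * (\<Sum>i<Suc K. (3 ^ (CARD('n) - 1)) ^ i)"
      using j L level_set act by (rule run_calls)
    finally show ?thesis
      using that(2)[of K] run_after_removal[OF j L(1) act inact, of m0] m0[of "Suc K + m0"] by simp
  qed
qed

lemma output_error_le:
  assumes out: "alg_output (q_inf P X \<alpha> f) f N q"
  shows "\<bar>q - q\<alpha>\<bar> \<le> L * sqrt (real CARD('n))"
proof -
  obtain m where m: "q_val (run N m) = Some q"
    using out unfolding alg_output_def eventually_sequentially by blast
  have jmax: "1 \<le> j_max N"
  proof (rule ccontr)
    assume "\<not> 1 \<le> j_max N"
    then have "run N m = init N"
      by (induction m) (auto simp: run_0 run_Suc init_def)
    then show False using m by (simp add: init_def)
  qed
  have "sound N (run N m) \<and> (\<forall>q. q_val (run N m) = Some q \<longrightarrow> \<bar>q - q\<alpha>\<bar> \<le> L * sqrt (real CARD('n)))"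
  proof (induction m)
    case 0
    then show ?case using sound_init[OF jmax] by (simp add: run_0) (simp add: init_def)
  next
    case (Suc m)
    then show ?case
      using sound_next_state(1)[of N "run N m"] sound_error[of N "run N m"]
      by (auto simp: run_Suc body_simps)
  qed
  then show ?thesis using m by blast
qed

text \<open>A state depends on the estimator only through the computed values, so as long as both
  expressions agree the two runs coincide.\<close>

lemma trace_q_sup_eq:
  assumes "expressions_agree P X \<alpha> f N"
  shows "trace (q_sup P X \<alpha> f) f N m = run N m"
proof (induction m)
  case 0
  then show ?case by (simp add: trace_def)
next
  case (Suc m)
  let ?s = "trace (q_sup P X \<alpha> f) f N m"
  have "body (q_sup P X \<alpha> f) f N ?s = next_state N ?s" if "running ?s"
  proof -
    have "cur_q (q_sup P X \<alpha> f) f N ?s = q_at N ?s"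
      using assms that unfolding expressions_agree_def Let_def by blast
    then show ?thesis unfolding body_def by simp
  qed
  moreover have "trace (q_sup P X \<alpha> f) f N (Suc m) = (if running ?s then body (q_sup P X \<alpha> f) f N ?s else ?s)"
    by (simp add: trace_def)
  ultimately show ?case using Suc by (simp add: run_Suc)
qed

end

section \<open>The numerical bounds\<close>

lemma le_j_max:
  assumes "pi\<^sup>2 * (real j + 1)\<^sup>2 \<le> 6 * real N"
  shows "j \<le> j_max N"
proof -
  have N_max: "1 \<le> N_max i N \<longleftrightarrow> pi\<^sup>2 * (real i + 1)\<^sup>2 \<le> 6 * real N" for i
  proof -
    have "0 < pi\<^sup>2 * (real i + 1)\<^sup>2" by (simp add: add_nonneg_eq_0_iff)
    then have "1 \<le> 6 * real N / (pi\<^sup>2 * (real i + 1)\<^sup>2) \<longleftrightarrow> pi\<^sup>2 * (real i + 1)\<^sup>2 \<le> 6 * real N"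
      by (simp add: le_divide_eq)
    moreover have "1 \<le> nat \<lfloor>y\<rfloor> \<longleftrightarrow> 1 \<le> y" for y :: real
      by linarith
    ultimately show ?thesis unfolding N_max_def by simp
  qed
  have "i \<le> 6 * N" if "1 \<le> N_max i N" for i
  proof -
    have "1 * (real i + 1) \<le> pi\<^sup>2 * (real i + 1)\<^sup>2"
      unfolding power2_eq_square[of "real i + 1"] using pi_ge_two
      by (intro mult_mono) (auto intro: order_trans[OF _ power_mono[of 2 pi 2]])
    then have "real i \<le> real (6 * N)" using that N_max by simp
    then show ?thesis by (simp only: of_nat_le_iff)
  qed
  then have "bdd_above {i. 1 \<le> N_max i N}" by (intro bdd_aboveI[of _ "6 * N"]) simp
  then show ?thesis unfolding j_max_def using assms N_max by (intro cSup_upper) auto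
qed

text \<open>The candidates are powers of three, so one of them lies between \<open>L\<close> and \<open>3 * L\<close>.  As the index
  \<open>0\<close> is excluded, \<open>j = 1\<close> is taken for \<open>L \<le> 3\<close>.\<close>

lemma exists_good_candidate:
  assumes "1 \<le> L"
  obtains j where "1 \<le> j" "L \<le> L_cand j" "L_cand j \<le> 3 * L" "real j + 1 \<le> ln L / ln 3 + 2"
proof (cases "L \<le> 3")
  case True
  have "0 \<le> ln L / ln 3" using assms by simp
  then show ?thesis using that[of 1] True assms by (simp add: L_cand_def)
next
  case False
  define t where "t = ln L / ln 3"
  have "1 < t" using False assms by (simp add: t_def)
  define j where "j = nat \<lceil>t\<rceil>"
  have j: "t \<le> real j" "real j \<le> t + 1" using \<open>1 < t\<close> unfolding j_def by linarith+
  have cand: "L_cand j = 3 powr real j" by (simp add: L_cand_def powr_realpow)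
  have L: "L = 3 powr t" using assms by (simp add: t_def powr_def)
  have "3 * L = 3 powr (t + 1)" by (simp add: L powr_add)
  then show ?thesis using that[of j] j \<open>1 < t\<close> by (simp add: cand L t_def[symmetric])
qed

lemma N_max_gt:
  assumes "real j + 1 \<le> A"
  shows "6 * real N / (pi\<^sup>2 * A\<^sup>2) - 1 < real (N_max j N)"
proof -
  have "pi\<^sup>2 * (real j + 1)\<^sup>2 \<le> pi\<^sup>2 * A\<^sup>2"
    using assms by (intro mult_left_mono power_mono) auto
  moreover have "0 < pi\<^sup>2 * (real j + 1)\<^sup>2" by (simp add: add_nonneg_eq_0_iff)
  ultimately have "6 * real N / (pi\<^sup>2 * A\<^sup>2) \<le> 6 * real N / (pi\<^sup>2 * (real j + 1)\<^sup>2)"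
    by (intro divide_left_mono mult_pos_pos) auto
  then show ?thesis unfolding N_max_def by linarith
qed

text \<open>With \<open>q = 3 ^ (d - 1)\<close> the factor is \<open>3 ^ d - 1\<close>; it is at most \<open>4 * (q - 1)\<close>, and the factor \<open>q - 1\<close>
  telescopes the sum.\<close>

lemma geometric_sum_le:
  fixes q :: real
  assumes "3 \<le> q"
  shows "(3 * q - 1) * (\<Sum>i<n. q ^ i) \<le> 4 * q ^ n"
proof -
  have "(3 * q - 1) * (\<Sum>i<n. q ^ i) \<le> (4 * (q - 1)) * (\<Sum>i<n. q ^ i)"
    using assms by (intro mult_right_mono sum_nonneg) auto
  also have "\<dots> = 4 * (q ^ n - 1)"
    using power_diff_1_eq[of q n] by (simp add: mult.assoc)
  finally show ?thesis by simp
qed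

lemma three_powr_minus_Suc: "c / 3 ^ K = 3 * c * 3 powr (- real (Suc K))" for c :: real
proof -
  have "3 powr (- real (Suc K)) = 1 / (3 :: real) ^ Suc K"
    by (simp only: powr_minus powr_realpow zero_less_numeral divide_inverse mult_1)
  then show ?thesis by simp
qed

text \<open>With \<open>u = N / (pi\<^sup>2 * A\<^sup>2)\<close> the budget inequality reads \<open>6 * u - 2 < 8 * M * L * (K + 1)\<close>, which gives
  \<open>K + 1 \<ge> (u - 1) / (2 * M * L)\<close>, and the right-hand side of the conclusion is
  \<open>18 * L * 3 powr - ((u - 1) / (2 * M * L))\<close>.\<close>

lemma error_dim_one:
  assumes "1 \<le> L" "0 < M"
    and err: "e \<le> L / 3 ^ K" and budget: "6 * real N / (pi\<^sup>2 * A\<^sup>2) - 1 < 1 + 8 * M * L * real (Suc K)"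
  shows "e \<le> 18 * L * 3 powr (1 / (2 * M * L)) * (3 powr (- (1 / (A\<^sup>2 * 2 * pi\<^sup>2 * M * L)))) ^ N"
proof -
  define u where "u = real N / (pi\<^sup>2 * A\<^sup>2)"
  have "0 \<le> u" by (simp add: u_def)
  have prod_pos: "0 < M * L" using assms by simp
  have "6 * u - 2 < 8 * (M * L) * real (Suc K)" using budget by (simp add: u_def mult.assoc)
  then have "(u - 1) / 2 \<le> (M * L) * real (Suc K)" using \<open>0 \<le> u\<close> by simp
  then have "u - 1 \<le> real (Suc K) * (2 * (M * L))" by (simp add: mult_ac)
  then have ineq: "(u - 1) / (2 * (M * L)) \<le> real (Suc K)"
    using prod_pos by (simp only: pos_divide_le_eq mult_pos_pos zero_less_numeral)
  have "(3 powr (- (1 / (A\<^sup>2 * 2 * pi\<^sup>2 * M * L)))) ^ N = 3 powr (- u / (2 * (M * L)))"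
    by (simp add: powr_power u_def field_simps)
  then have rhs: "3 powr (1 / (2 * M * L)) * (3 powr (- (1 / (A\<^sup>2 * 2 * pi\<^sup>2 * M * L)))) ^ N
      = 3 powr (- ((u - 1) / (2 * (M * L))))"
    by (simp add: powr_add[symmetric] diff_divide_distrib mult.assoc)
  have "e \<le> L / 3 ^ K" by (rule err)
  also have "\<dots> = 3 * L * 3 powr (- real (Suc K))"
    by (rule three_powr_minus_Suc)
  also have "\<dots> \<le> 18 * L * 3 powr (- ((u - 1) / (2 * (M * L))))"
    using ineq assms by (intro mult_mono) auto
  finally show ?thesis unfolding mult.assoc[of "18 * L"] rhs .
qed

text \<open>The budget inequality bounds the excess \<open>D\<close> of \<open>N\<close> over \<open>pi\<^sup>2 / 3 * A\<^sup>2\<close> by a multiple of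
  \<open>3 ^ ((d - 1) * (K + 1))\<close>; taking \<open>(d - 1)\<close>-th roots bounds \<open>3 ^ - (K + 1)\<close>.\<close>

lemma error_dim_gt_one:
  assumes "1 \<le> L" "0 < M" "0 < A" "1 < d"
    and N: "pi\<^sup>2 / 3 * A\<^sup>2 < real N"
    and err: "e \<le> L * sqrt (real d) / 3 ^ K"
    and budget: "6 * real N / (pi\<^sup>2 * A\<^sup>2) - 1
      < 1 + (3 ^ d - 1) * (4 * M * L * sqrt (real d)) * (\<Sum>i<Suc K. (3 ^ (d - 1)) ^ i)"
  shows "e \<le> 18 * L * sqrt (real d) *
      (3 ^ d * M * L * sqrt (real d) * (pi\<^sup>2 / 2) * A\<^sup>2) powr (1 / (real d - 1))
      * (real N - pi\<^sup>2 / 3 * A\<^sup>2) powr (- (1 / (real d - 1)))"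
proof -
  define p where "p = real d - 1"
  define q :: real where "q = 3 ^ (d - 1)"
  define W where "W = M * L * sqrt (real d)"
  define D where "D = real N - pi\<^sup>2 / 3 * A\<^sup>2"
  define B where "B = 3 ^ d * M * L * sqrt (real d) * (pi\<^sup>2 / 2) * A\<^sup>2"
  have p: "0 < p" using assms by (simp add: p_def)
  have W: "0 < W" using assms by (simp add: W_def)
  have D: "0 < D" using N by (simp add: D_def)
  have a: "0 < pi\<^sup>2 * A\<^sup>2" using assms by simp
  have d: "(3 :: real) ^ d = 3 * q" using assms by (simp add: q_def power_eq_if)
  have q: "3 \<le> q" unfolding q_def using power_increasing[of 1 "d - 1" "3 :: real"] assms by simp
  have "6 * D / (pi\<^sup>2 * A\<^sup>2) = 6 * real N / (pi\<^sup>2 * A\<^sup>2) - 2"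
  proof -
    have "6 * (n - c / 3) / c = 6 * n / c - 2" if "0 < c" for n c :: real
      using that by (simp add: diff_divide_distrib right_diff_distrib)
    from this[OF a] show ?thesis by (simp add: D_def)
  qed
  also have "\<dots> < 4 * W * ((3 * q - 1) * (\<Sum>i<Suc K. q ^ i))"
  proof -
    define S where "S = (\<Sum>i<Suc K. q ^ i)"
    have "6 * real N / (pi\<^sup>2 * A\<^sup>2) - 1 < 1 + (3 * q - 1) * (4 * M * L * sqrt (real d)) * S"
      using budget unfolding d q_def[symmetric] S_def[symmetric] .
    moreover have "(3 * q - 1) * (4 * M * L * sqrt (real d)) * S = 4 * W * ((3 * q - 1) * S)"
      by (simp add: W_def)
    ultimately show ?thesis unfolding S_def by linarith
  qed
  also have "\<dots> \<le> 4 * W * (4 * q ^ Suc K)"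
    using W by (intro mult_left_mono geometric_sum_le q) auto
  finally have "D < (16 / 6 * W * (pi\<^sup>2 * A\<^sup>2)) * q ^ Suc K"
    using a by (simp add: divide_less_eq mult_ac)
  also have "\<dots> \<le> B * q ^ Suc K"
  proof -
    have "B = (3 * q / 2) * W * (pi\<^sup>2 * A\<^sup>2)" by (simp add: B_def W_def d)
    also have "\<dots> \<ge> 16 / 6 * W * (pi\<^sup>2 * A\<^sup>2)"
      using q W a by (intro mult_right_mono) auto
    finally show ?thesis using q by (intro mult_right_mono) auto
  qed
  finally have DB: "D \<le> B * q ^ Suc K" by simp
  have B: "0 < B" using assms by (simp add: B_def)
  have "q ^ Suc K = (3 powr real (Suc K)) powr p"
  proof -
    have "q ^ Suc K = 3 powr (real ((d - 1) * Suc K))"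
      unfolding q_def by (simp only: power_mult[symmetric] powr_realpow zero_less_numeral)
    also have "real ((d - 1) * Suc K) = real (Suc K) * p"
    proof -
      have "real (d - 1) = p" using \<open>1 < d\<close> by (simp add: p_def of_nat_diff)
      then show ?thesis by (simp only: of_nat_mult mult.commute)
    qed
    finally show ?thesis by (simp only: powr_powr)
  qed
  then have "D powr (1 / p) \<le> (B * (3 powr real (Suc K)) powr p) powr (1 / p)"
    using DB D p by (intro powr_mono2) auto
  also have "\<dots> = B powr (1 / p) * 3 powr real (Suc K)"
    using B p by (simp add: powr_mult powr_powr)
  finally have "3 powr (- real (Suc K)) \<le> B powr (1 / p) * D powr (- (1 / p))"
  proof -
    assume le: "D powr (1 / p) \<le> B powr (1 / p) * 3 powr real (Suc K)"
    have inv: "inverse t \<le> b * inverse x" if "x \<le> b * t" "0 < x" "0 < t" for x t b :: real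
      using that by (simp add: field_simps)
    show ?thesis
      unfolding powr_minus by (rule inv[OF le]) (use D in simp_all)
  qed
  moreover have "e \<le> 3 * L * sqrt (real d) * 3 powr (- real (Suc K))"
  proof -
    have "L * sqrt (real d) / 3 ^ K = 3 * L * sqrt (real d) * 3 powr (- real (Suc K))"
      by (simp only: three_powr_minus_Suc mult.assoc)
    then show ?thesis using err by simp
  qed
  moreover have "3 * L * sqrt (real d) * 3 powr (- real (Suc K))
      \<le> 18 * L * sqrt (real d) * 3 powr (- real (Suc K))"
    using assms by (intro mult_right_mono) auto
  moreover have "0 \<le> 18 * L * sqrt (real d)" using assms by simp
  ultimately have "e \<le> 18 * L * sqrt (real d) * (B powr (1 / p) * D powr (- (1 / p)))"
    by (meson mult_left_mono order_trans)
  then show ?thesis by (simp add: B_def D_def p_def mult.assoc)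
qed


section \<open>The error of the algorithm\<close>

theorem theorem3p1:
  fixes P :: "'a measure" and X :: "'a \<Rightarrow> real ^ 'n" and f :: "real ^ 'n \<Rightarrow> real"
    and \<alpha> L M q\<alpha> qN :: real and N :: nat
  assumes "prob_space P"
    and "X \<in> borel_measurable P"
    and "\<And>\<omega>. \<omega> \<in> space P \<Longrightarrow> X \<omega> \<in> unit_cube"
    and "0 < \<alpha>" "\<alpha> < 1"
    and q\<alpha>: "q\<alpha> = quantile P (\<lambda>\<omega>. f (X \<omega>)) \<alpha>"
    and "L \<ge> 1"
    and lipschitz: "\<And>x y. x \<in> unit_cube \<Longrightarrow> y \<in> unit_cube \<Longrightarrow> \<bar>f x - f y\<bar> \<le> L * norm (x - y)"
    and "M > 0"
    and level_set: "\<And>\<delta>. \<delta> > 0 \<Longrightarrow>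
      measure lebesgue {x \<in> unit_cube. f x \<in> {q\<alpha> - \<delta> .. q\<alpha> + \<delta>}} \<le> M * \<delta>"
    and "N \<ge> 1"
    and qN: "alg_output (q_sup P X \<alpha> f) f N qN \<and> expressions_agree P X \<alpha> f N
      \<or> alg_output (q_inf P X \<alpha> f) f N qN"
  shows "(CARD('n) = 1 \<longrightarrow>
      (let C = 18 * L * 3 powr (1 / (2 * M * L));
           \<rho> = 3 powr (- (1 / ((ln L / ln 3 + 2)\<^sup>2 * 2 * pi\<^sup>2 * M * L)))
       in \<bar>q\<alpha> - qN\<bar> \<le> C * \<rho> ^ N))
    \<and> (CARD('n) > 1 \<longrightarrow> real N > pi\<^sup>2 / 3 * (ln L / ln 3 + 2)\<^sup>2 \<longrightarrow>
      (let d = real CARD('n);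
           C = 18 * L * sqrt d *
             (3 ^ CARD('n) * M * L * sqrt d * (pi\<^sup>2 / 2) * (ln L / ln 3 + 2)\<^sup>2) powr (1 / (d - 1))
       in \<bar>q\<alpha> - qN\<bar> \<le> C * (real N - pi\<^sup>2 / 3 * (ln L / ln 3 + 2)\<^sup>2) powr (- (1 / (d - 1)))))"
proof -
  interpret lipschitz_quantile P X f \<alpha> L q\<alpha>
    by (intro lipschitz_quantile.intro lipschitz_quantile_axioms.intro) fact+
  have out: "alg_output (q_inf P X \<alpha> f) f N qN"
    using qN trace_q_sup_eq unfolding alg_output_def by auto
  define A where "A = ln L / ln 3 + 2"
  have A: "0 < A" using \<open>L \<ge> 1\<close> by (simp add: A_def add_nonneg_pos)
  obtain j where j: "1 \<le> j" "L \<le> L_cand j" "L_cand j \<le> 3 * L" "real j + 1 \<le> A"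
    using exists_good_candidate[OF \<open>L \<ge> 1\<close>] unfolding A_def by blast
  have sq: "pi\<^sup>2 * (real j + 1)\<^sup>2 \<le> pi\<^sup>2 * A\<^sup>2"
    using j(4) by (intro mult_left_mono power_mono) auto
  have main: "q\<alpha> = qN \<or> (\<exists>K. \<bar>q\<alpha> - qN\<bar> \<le> L * sqrt (real CARD('n)) / 3 ^ K \<and>
      6 * real N / (pi\<^sup>2 * A\<^sup>2) - 1 < 1 + (3 ^ CARD('n) - 1) * (4 * M * L * sqrt (real CARD('n))) *
        (\<Sum>i<Suc K. (3 ^ (CARD('n) - 1)) ^ i))"
    if N: "pi\<^sup>2 * A\<^sup>2 \<le> 6 * real N"
  proof -
    have "j \<in> {1..j_max N}" using j(1) le_j_max[of j N] sq N by simp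
    then show ?thesis
    proof (rule output_error_or_budget_exceeded[OF _ j(2,3) level_set out])
      assume "qN = q\<alpha>"
      then show ?thesis by simp
    next
      fix K
      assume "\<bar>qN - q\<alpha>\<bar> \<le> 2 * L * radius CARD('n) K"
      moreover have "2 * L * radius CARD('n) K = L * sqrt (real CARD('n)) / 3 ^ K"
        by (simp add: radius_def)
      ultimately have err: "\<bar>q\<alpha> - qN\<bar> \<le> L * sqrt (real CARD('n)) / 3 ^ K"
        by (simp only: abs_minus_commute)
      assume "real (N_max j N) < 1 + (3 ^ CARD('n) - 1) * (4 * M * L * sqrt (real CARD('n))) *
        (\<Sum>i<Suc K. (3 ^ (CARD('n) - 1)) ^ i)"
      then show ?thesis using N_max_gt[OF j(4), of N] err by (meson order_less_trans)
    qed
  qed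
  have dim_1: "\<bar>q\<alpha> - qN\<bar> \<le> 18 * L * 3 powr (1 / (2 * M * L)) *
      (3 powr (- (1 / (A\<^sup>2 * 2 * pi\<^sup>2 * M * L)))) ^ N" if d: "CARD('n) = 1"
  proof -
    consider "q\<alpha> = qN" | K where "\<bar>q\<alpha> - qN\<bar> \<le> L / 3 ^ K"
        "6 * real N / (pi\<^sup>2 * A\<^sup>2) - 1 < 1 + 8 * M * L * real (Suc K)"
    proof (cases "pi\<^sup>2 * A\<^sup>2 \<le> 6 * real N")
      case True
      then show ?thesis using main[OF True] that unfolding d by (auto simp: mult_ac)
    next
      case False
      \<comment> \<open>The budget of the candidate is below one call; the trivial bound is the case \<open>K = 0\<close>.\<close>
      then have "6 * real N / (pi\<^sup>2 * A\<^sup>2) - 1 < 0" using A by (simp add: divide_less_eq)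
      moreover have "0 < 8 * M * L * real (Suc 0)" using \<open>M > 0\<close> \<open>L \<ge> 1\<close> by simp
      moreover have "\<bar>q\<alpha> - qN\<bar> \<le> L / 3 ^ 0"
        using output_error_le[OF out] by (simp add: d abs_minus_commute)
      ultimately show ?thesis using that(2)[of 0] by linarith
    qed
    then show ?thesis
    proof cases
      case 1
      then show ?thesis using \<open>L \<ge> 1\<close> by simp
    next
      case 2
      then show ?thesis using \<open>L \<ge> 1\<close> \<open>M > 0\<close> by (intro error_dim_one)
    qed
  qed
  have dim_gt_1: "\<bar>q\<alpha> - qN\<bar> \<le> 18 * L * sqrt (real CARD('n)) *
      (3 ^ CARD('n) * M * L * sqrt (real CARD('n)) * (pi\<^sup>2 / 2) * A\<^sup>2) powr (1 / (real CARD('n) - 1))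
      * (real N - pi\<^sup>2 / 3 * A\<^sup>2) powr (- (1 / (real CARD('n) - 1)))"
    if d: "CARD('n) > 1" and N: "real N > pi\<^sup>2 / 3 * A\<^sup>2"
  proof -
    have "pi\<^sup>2 * A\<^sup>2 \<le> 6 * real N"
    proof -
      have "0 \<le> pi\<^sup>2 * A\<^sup>2" by simp
      then show ?thesis using N by simp
    qed
    from main[OF this] show ?thesis
    proof (elim disjE exE conjE)
      assume "q\<alpha> = qN"
      then show ?thesis using \<open>L \<ge> 1\<close> by simp
    next
      fix K
      assume err: "\<bar>q\<alpha> - qN\<bar> \<le> L * sqrt (real CARD('n)) / 3 ^ K"
        and budget: "6 * real N / (pi\<^sup>2 * A\<^sup>2) - 1 < 1 + (3 ^ CARD('n) - 1) *
          (4 * M * L * sqrt (real CARD('n))) * (\<Sum>i<Suc K. (3 ^ (CARD('n) - 1)) ^ i)"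
      show ?thesis
        by (rule error_dim_gt_one[OF \<open>L \<ge> 1\<close> \<open>M > 0\<close> A d N err budget])
    qed
  qed
  show ?thesis
    using dim_1 dim_gt_1 unfolding Let_def A_def by blast
qed

end
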